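(* Let $X,Y$ be metric spaces, $X\times Y$ with the maximum metric, and let $g,h$ be Hausdorff functions. For any set $E\subseteq X\times Y$: (i) $\overline{\mathcal B}^{gh}(E)\ge\int^*\vec{\mathcal B}^{g}(E_x)\,d\overline{\mathcal B}^{h}(x)$; (ii) $\underline{\mathcal B}^{gh}(E)\ge\int^*\underline{\mathcal B}^{g}(E_x)\,d\underline{\mathcal B}^{h}(x)$; (iii) $\vec{\mathcal B}^{gh}(E)\ge\int^*\vec{\mathcal B}^{g}(E_x)\,d\underline{\mathcal B}^{h}(x)$; (iv) $\vec{\mathcal B}^{gh}(E)\ge\inf_{x\in X}\vec{\mathcal B}^{g}(E_x)\cdot\vec{\mathcal B}^{h}(X)$.
   Context: In a metric space $(X,d)$: $\operatorname{gap}F=\inf\{d(x,y):x,y\in F,x\neq y\}$, $C_\delta(E)=\sup\{|F|:F\subseteq E,\operatorname{gap}F>\delta\}$. A Hausdorff function is a nondecreasing $g:(0,\infty)\to(0,\infty)$; $gh$ is the pointwise product. Let $\overline{\mathcal B}^g_0(E)=\limsup_{\delta\to0}C_\delta(E)g(\delta)$ and $\underline{\mathcal B}^g_0(E)=\liminf_{\delta\to0}C_\delta(E)g(\delta)$. For a set function $\tau$ let $\widehat\tau(E)=\inf\{\sum_n\tau(E_n):E\subseteq\bigcup_nE_n\}$ (countable covers) and $\overrightarrow\tau(E)=\inf\{\sup_n\tau(E_n):E_n\uparrow E\}$, where $E_n\uparrow E$ means $(E_n)$ is increasing with union $E$. Then $\overline{\mathcal B}^g=\widehat{\overline{\mathcal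 B}^g_0}$ (upper box measure), $\underline{\mathcal B}^g=\widehat{\underline{\mathcal B}^g_0}$ (Hewitt–Stromberg measure), $\vec{\mathcal B}^g=\overrightarrow{\underline{\mathcal B}^g_0}$. The set functions $\overline{\mathcal B}^h,\underline{\mathcal B}^h$ are Borel measures when restricted to Borel sets. $E_x=\{y:(x,y)\in E\}$. Upper integral: $\int^*f\,d\mu=\inf\{\int\varphi\,d\mu:\varphi\ge f$ Borel measurable$\}$.
   Formalization: In (i) the upper box measure for h need not be additive on Borel sets (two separated Cantor sets large at complementary scales), so the integral may be undefined; (i) is proved whenever it is a Borel measure on X, and otherwise the integral is read as 0. *)

theory Defs
  imports "HOL-Analysis.Analysis"
begin

definition hausdorff_fun :: "(real \<Rightarrow> real) \<Rightarrow> bool" where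
  "hausdorff_fun g \<longleftrightarrow> (\<forall>t>0. g t > 0) \<and> mono_on {0<..} g"

text \<open>gap F = inf of distances of distinct points (infinity if |F| <= 1).\<close>
definition gap :: "('a \<Rightarrow> 'a \<Rightarrow> real) \<Rightarrow> 'a set \<Rightarrow> ereal" where
  "gap d F = Inf {ereal (d x y) | x y. x \<in> F \<and> y \<in> F \<and> x \<noteq> y}"

definition capC :: "('a \<Rightarrow> 'a \<Rightarrow> real) \<Rightarrow> real \<Rightarrow> 'a set \<Rightarrow> ennreal" where
  "capC d \<delta> E = Sup {(if finite F then of_nat (card F) else \<infinity>) | F. F \<subseteq> E \<and> gap d F > ereal \<delta>}"

definition upper_box0 :: "('a \<Rightarrow> 'a \<Rightarrow> real) \<Rightarrow> (real \<Rightarrow> real) \<Rightarrow> 'a set \<Rightarrow> ennreal" where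
  "upper_box0 d g E = Limsup (at_right 0) (\<lambda>\<delta>. capC d \<delta> E * ennreal (g \<delta>))"

definition lower_box0 :: "('a \<Rightarrow> 'a \<Rightarrow> real) \<Rightarrow> (real \<Rightarrow> real) \<Rightarrow> 'a set \<Rightarrow> ennreal" where
  "lower_box0 d g E = Liminf (at_right 0) (\<lambda>\<delta>. capC d \<delta> E * ennreal (g \<delta>))"

definition hat :: "('a set \<Rightarrow> ennreal) \<Rightarrow> 'a set \<Rightarrow> ennreal" where
  "hat \<tau> E = (INF A \<in> {A :: nat \<Rightarrow> 'a set. E \<subseteq> (\<Union>n. A n)}. \<Sum>n. \<tau> (A n))"

definition arrow :: "('a set \<Rightarrow> ennreal) \<Rightarrow> 'a set \<Rightarrow> ennreal" where
  "arrow \<tau> E = (INF A \<in> {A :: nat \<Rightarrow> 'a set. incseq A \<and> (\<Union>n. A n) = E}. SUP n. \<tau> (A n))"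

definition upper_box :: "('a \<Rightarrow> 'a \<Rightarrow> real) \<Rightarrow> (real \<Rightarrow> real) \<Rightarrow> 'a set \<Rightarrow> ennreal" where
  "upper_box d g = hat (upper_box0 d g)"

definition lower_box :: "('a \<Rightarrow> 'a \<Rightarrow> real) \<Rightarrow> (real \<Rightarrow> real) \<Rightarrow> 'a set \<Rightarrow> ennreal" where
  "lower_box d g = hat (lower_box0 d g)"

definition arrow_box :: "('a \<Rightarrow> 'a \<Rightarrow> real) \<Rightarrow> (real \<Rightarrow> real) \<Rightarrow> 'a set \<Rightarrow> ennreal" where
  "arrow_box d g = arrow (lower_box0 d g)"

definition maxdist :: "'a::metric_space \<times> 'b::metric_space \<Rightarrow> 'a \<times> 'b \<Rightarrow> real" where
  "maxdist p q = max (dist (fst p) (fst q)) (dist (snd p) (snd q))"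

definition xsection :: "('a \<times> 'b) set \<Rightarrow> 'a \<Rightarrow> 'b set" where
  "xsection E x = {y. (x, y) \<in> E}"

definition borel_restr :: "('a::topological_space set \<Rightarrow> ennreal) \<Rightarrow> 'a measure" where
  "borel_restr \<mu> = measure_of UNIV (sets borel) \<mu>"

definition upper_integral :: "'a measure \<Rightarrow> ('a \<Rightarrow> ennreal) \<Rightarrow> ennreal" where
  "upper_integral M f = (INF \<phi> \<in> {\<phi>. \<phi> \<in> borel_measurable M \<and> (\<forall>x. f x \<le> \<phi> x)}. integral\<^sup>N M \<phi>)"

end

theory Submission
  imports Defs
begin

text \<open>For a weight \<open>u\<close> on \<open>X\<close> let \<open>P\<^sub>\<delta>(u)\<close> be the supremum of \<open>\<Sum>x\<in>F. u x\<close> over finite \<open>F\<close> with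
  distances above \<open>\<delta>\<close>. Stacking separated subsets of the sections over a separated set of base
  points gives \<open>C\<^sub>\<delta>(E) g(\<delta>) \<ge> P\<^sub>\<delta>(u)\<close> for \<open>u(x) = inf {C\<^sub>t(E\<^sub>x) g(t) | t < 1/n}\<close> and \<open>\<delta> < 1/n\<close>, so
  everything reduces to bounding the upper integral of \<open>u\<close> by the upper or lower limit of
  \<open>P\<^sub>\<delta>(u) h(\<delta>)\<close>. Separation is an open condition, hence \<open>u\<close> may be replaced by its upper
  semicontinuous envelope, whose closed level sets differ by sets that are exhausted by pieces at
  positive distance from each other. For the lower limit the bound on such pieces is
  superadditivity. For the upper limit one first shrinks the pieces so that their upper box content
  is almost their measure; additivity of the measure then forces all pieces to be large at the same
  scales.\<close>

section \<open>Finite sums, suprema and upper and lower limits in \<open>ennreal\<close>\<close>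

text \<open>Addition in \<open>ennreal\<close> commutes with nonempty suprema, and the choices in
  the different \<open>B i\<close> are independent, so it suffices to bound every simultaneous
  choice \<open>f\<close>. The choices will be tail predicates, separated sets, nearby points or
  exhaustion indices.\<close>

lemma sum_SUP_le:
  fixes w :: "'i \<Rightarrow> 'c \<Rightarrow> ennreal"
  assumes "finite I" and "\<And>i. i \<in> I \<Longrightarrow> B i \<noteq> {}"
    and "\<And>f. (\<And>i. i \<in> I \<Longrightarrow> f i \<in> B i) \<Longrightarrow> (\<Sum>i\<in>I. w i (f i)) \<le> R"
  shows "(\<Sum>i\<in>I. SUP b\<in>B i. w i b) \<le> R"
proof -
  \<comment> \<open>The accumulator \<open>K\<close> holds the terms already chosen, so that the
    induction hypothesis applies once \<open>b\<close> is fixed for the new index.\<close>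
  have "K + (\<Sum>i\<in>I. SUP b\<in>B i. w i b) \<le> R"
    if "\<And>f. (\<And>i. i \<in> I \<Longrightarrow> f i \<in> B i) \<Longrightarrow> K + (\<Sum>i\<in>I. w i (f i)) \<le> R" for K
    using assms(1,2) that
  proof (induction I arbitrary: K rule: finite_induct)
    case empty
    then show ?case by simp
  next
    case (insert j I)
    have "(K + w j b) + (\<Sum>i\<in>I. SUP b\<in>B i. w i b) \<le> R" if b: "b \<in> B j" for b
    proof (rule insert.IH)
      fix f assume f: "\<And>i. i \<in> I \<Longrightarrow> f i \<in> B i"
      have "K + (\<Sum>i\<in>insert j I. w i ((f(j := b)) i)) \<le> R"
        by (rule insert.prems) (use b f in auto)
      also have "(\<Sum>i\<in>insert j I. w i ((f(j := b)) i)) = w j b + (\<Sum>i\<in>I. w i (f i))"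
        using insert.hyps by (subst sum.insert) (auto intro!: sum.cong)
      finally show "(K + w j b) + (\<Sum>i\<in>I. w i (f i)) \<le> R"
        by (simp add: add.assoc)
    qed (use insert.prems in auto)
    then have "(SUP b\<in>B j. w j b + (K + (\<Sum>i\<in>I. SUP b\<in>B i. w i b))) \<le> R"
      by (intro SUP_least) (simp add: ac_simps)
    then show ?case
      using insert.hyps insert.prems(1)
      by (subst (asm) ennreal_SUP_add_left) (auto simp: ac_simps)
  qed
  from this[of 0] assms(3) show ?thesis by simp
qed

text \<open>Finitely many eventual predicates hold simultaneously; on their intersection the infima
  add up below the sum.\<close>

lemma sum_Liminf_le:
  fixes f :: "'i \<Rightarrow> 'c \<Rightarrow> ennreal"
  assumes "finite I"
  shows "(\<Sum>i\<in>I. Liminf F (f i)) \<le> Liminf F (\<lambda>x. \<Sum>i\<in>I. f i x)"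
  unfolding Liminf_def[of F "f _"]
proof (rule sum_SUP_le[OF assms])
  fix i show "{P. eventually P F} \<noteq> {}"
    using eventually_True by blast
next
  fix P assume P: "\<And>i. i \<in> I \<Longrightarrow> P i \<in> {P. eventually P F}"
  have "\<forall>\<^sub>F x in F. \<forall>i\<in>I. P i x"
    using P assms by (simp add: eventually_ball_finite)
  then have "\<forall>\<^sub>F x in F. (\<Sum>i\<in>I. INF x\<in>Collect (P i). f i x) \<le> (\<Sum>i\<in>I. f i x)"
    by eventually_elim (auto intro!: sum_mono INF_lower)
  then show "(\<Sum>i\<in>I. INF x\<in>Collect (P i). f i x) \<le> Liminf F (\<lambda>x. \<Sum>i\<in>I. f i x)"
    by (rule Liminf_bounded)
qed

lemma mult_Liminf_le:
  fixes f :: "'c \<Rightarrow> ennreal"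
  shows "c * Liminf F f \<le> Liminf F (\<lambda>x. c * f x)"
  unfolding Liminf_def SUP_mult_left_ennreal
  by (intro SUP_mono) (auto intro!: INF_greatest mult_left_mono INF_lower)

lemma Limsup_add_le:
  fixes f g :: "'c \<Rightarrow> ennreal"
  shows "Limsup F (\<lambda>x. f x + g x) \<le> Limsup F f + Limsup F g"
proof (rule ennreal_le_epsilon)
  fix e :: real assume fin: "Limsup F f + Limsup F g < top" and e: "0 < e"
  have "\<forall>\<^sub>F x in F. f x < Limsup F f + ennreal (e/2)"
    using fin e by (intro Limsup_lessD) (auto simp: ennreal_add_left_cancel_less less_top)
  moreover have "\<forall>\<^sub>F x in F. g x < Limsup F g + ennreal (e/2)"
    using fin e by (intro Limsup_lessD) (auto simp: ennreal_add_left_cancel_less less_top)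
  ultimately have "\<forall>\<^sub>F x in F. f x + g x \<le> Limsup F f + Limsup F g + ennreal e"
  proof eventually_elim
    case (elim x)
    then have "f x + g x \<le> (Limsup F f + ennreal (e/2)) + (Limsup F g + ennreal (e/2))"
      by (intro add_mono) auto
    also have "\<dots> = Limsup F f + Limsup F g + (ennreal (e/2) + ennreal (e/2))"
      by (simp add: ac_simps)
    also have "ennreal (e/2) + ennreal (e/2) = ennreal e"
      using e by (simp flip: ennreal_plus)
    finally show ?case .
  qed
  then show "Limsup F (\<lambda>x. f x + g x) \<le> Limsup F f + Limsup F g + ennreal e"
    by (rule Limsup_bounded)
qed

lemma Limsup_sum_le:
  fixes f :: "'i \<Rightarrow> 'c \<Rightarrow> ennreal"
  assumes "finite I"
  shows "Limsup F (\<lambda>x. \<Sum>i\<in>I. f i x) \<le> (\<Sum>i\<in>I. Limsup F (f i))"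
  using assms
proof (induction I rule: finite_induct)
  case empty
  show ?case by (rule Limsup_bounded) simp
next
  case (insert i I)
  then show ?case
    using Limsup_add_le[of F "f i" "\<lambda>x. \<Sum>i\<in>I. f i x"]
    by (simp add: order_trans add_left_mono)
qed

text \<open>Multiplication by a finite \<open>c\<close> is continuous; multiplication by
  \<open>top\<close> jumps at 0, which is why finite weights matter for upper limits.\<close>

lemma Limsup_cmult_ennreal:
  fixes f :: "'c \<Rightarrow> ennreal"
  assumes "c < top" and "F \<noteq> bot"
  shows "Limsup F (\<lambda>x. c * f x) = c * Limsup F f"
  using assms by (intro Limsup_compose_continuous_mono monoI mult_left_mono ennreal_continuous_on_cmult continuous_on_id) auto

section \<open>Separated sets and the capacity \<open>capC\<close>\<close>

text \<open>Restricted to finite sets because \<open>card\<close> and \<open>sum\<close> degenerate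
  to 0 on infinite ones.\<close>

definition separated :: "('a \<Rightarrow> 'a \<Rightarrow> real) \<Rightarrow> real \<Rightarrow> 'a set \<Rightarrow> 'a set set" where
  "separated d \<delta> E = {F. finite F \<and> F \<subseteq> E \<and> (\<forall>x\<in>F. \<forall>y\<in>F. x \<noteq> y \<longrightarrow> d x y > \<delta>)}"

lemma separatedI:
  "finite F \<Longrightarrow> F \<subseteq> E \<Longrightarrow> (\<And>x y. x \<in> F \<Longrightarrow> y \<in> F \<Longrightarrow> x \<noteq> y \<Longrightarrow> d x y > \<delta>) \<Longrightarrow> F \<in> separated d \<delta> E"
  by (auto simp: separated_def)

lemma separated_empty: "{} \<in> separated d \<delta> E"
  by (auto simp: separated_def)

lemma separated_finite: "F \<in> separated d \<delta> E \<Longrightarrow> finite F"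
  by (auto simp: separated_def)

lemma separated_subset: "F \<in> separated d \<delta> E \<Longrightarrow> F \<subseteq> E"
  by (auto simp: separated_def)

lemma separatedD: "F \<in> separated d \<delta> E \<Longrightarrow> x \<in> F \<Longrightarrow> y \<in> F \<Longrightarrow> x \<noteq> y \<Longrightarrow> d x y > \<delta>"
  by (auto simp: separated_def)

text \<open>A minimum over finitely many pairs is attained, so strictness passes between it and the
  single distances. With at most one point there are no pairs and the gap is infinite.\<close>

lemma gap_greater_iff:
  assumes "finite F"
  shows "gap d F > ereal \<delta> \<longleftrightarrow> (\<forall>x\<in>F. \<forall>y\<in>F. x \<noteq> y \<longrightarrow> d x y > \<delta>)"
proof -
  let ?S = "{ereal (d x y) | x y. x \<in> F \<and> y \<in> F \<and> x \<noteq> y}"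
  have "?S \<subseteq> (\<lambda>(x, y). ereal (d x y)) ` (F \<times> F)" by auto
  then have fin: "finite ?S"
    using assms by (meson finite_SigmaI finite_imageI finite_subset)
  show ?thesis
  proof (cases "?S = {}")
    case True
    then have "x = y" if "x \<in> F" "y \<in> F" for x y using that by blast
    then show ?thesis unfolding gap_def True by (auto simp: top_ereal_def)
  next
    case False
    then have "gap d F = Min ?S"
      unfolding gap_def using fin by (intro Min_Inf[symmetric]) auto
    then have "gap d F > ereal \<delta> \<longleftrightarrow> (\<forall>a\<in>?S. a > ereal \<delta>)"
      by (simp only: Min_gr_iff[OF fin False])
    also have "\<dots> \<longleftrightarrow> (\<forall>x\<in>F. \<forall>y\<in>F. x \<noteq> y \<longrightarrow> ereal (d x y) > ereal \<delta>)" by blast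
    finally show ?thesis by simp
  qed
qed

text \<open>An infinite set with large gap contains finite subsets of every cardinality, and these
  inherit the gap, so finite sets already produce the value \<open>top\<close>.\<close>

lemma capC_eq_SUP_separated: "capC d \<delta> E = (SUP F\<in>separated d \<delta> E. of_nat (card F))"
proof (rule antisym)
  show "capC d \<delta> E \<le> (SUP F\<in>separated d \<delta> E. of_nat (card F))"
    unfolding capC_def
  proof (rule Sup_least, safe)
    fix F assume F: "F \<subseteq> E" "ereal \<delta> < gap d F"
    show "(if finite F then of_nat (card F) else \<infinity>) \<le> (SUP F\<in>separated d \<delta> E. of_nat (card F) :: ennreal)"
    proof (cases "finite F")
      case True
      then show ?thesis
        using F by (auto simp: gap_greater_iff separated_def intro!: SUP_upper)
    next
      case False
      have "of_nat n \<le> (SUP F\<in>separated d \<delta> E. of_nat (card F) :: ennreal)" for n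
      proof -
        obtain G where G: "finite G" "card G = n" "G \<subseteq> F"
          using infinite_arbitrarily_large[OF False] by metis
        have "gap d F \<le> gap d G"
          unfolding gap_def using G by (intro Inf_superset_mono) auto
        then have "G \<in> separated d \<delta> E"
          using F G gap_greater_iff[of G \<delta> d] by (auto simp: separated_def)
        then show ?thesis using G by (auto intro: SUP_upper2)
      qed
      then have "(SUP n. of_nat n) \<le> (SUP F\<in>separated d \<delta> E. of_nat (card F) :: ennreal)"
        by (intro SUP_least)
      then show ?thesis using False by (simp only: ennreal_SUP_of_nat_eq_top infinity_ennreal_def if_False)
    qed
  qed
  show "(SUP F\<in>separated d \<delta> E. of_nat (card F)) \<le> capC d \<delta> E"
    unfolding capC_def
  proof (rule SUP_least, rule Sup_upper, safe)
    fix F assume "F \<in> separated d \<delta> E"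
    then show "\<exists>F'. of_nat (card F) = (if finite F' then of_nat (card F') else \<infinity> :: ennreal) \<and> F' \<subseteq> E \<and> ereal \<delta> < gap d F'"
      by (intro exI[of _ F]) (auto simp: separated_def gap_greater_iff)
  qed
qed

lemma separated_mono: "A \<subseteq> B \<Longrightarrow> separated d \<delta> A \<subseteq> separated d \<delta> B"
  by (auto simp: separated_def)

lemma capC_mono: "A \<subseteq> B \<Longrightarrow> capC d \<delta> A \<le> capC d \<delta> B"
  unfolding capC_eq_SUP_separated by (intro SUP_subset_mono separated_mono) auto

lemma capC_empty [simp]: "capC d \<delta> {} = 0"
  unfolding capC_eq_SUP_separated separated_def by (auto simp: bot_ennreal)

text \<open>A separated set is cut along the cover, and each part is separated within its
  \<open>A i\<close>.\<close>

lemma capC_UN_le: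
  assumes "finite I"
  shows "capC d \<delta> (\<Union>i\<in>I. A i) \<le> (\<Sum>i\<in>I. capC d \<delta> (A i))"
proof -
  have "of_nat (card F) \<le> (\<Sum>i\<in>I. capC d \<delta> (A i))" if F: "F \<in> separated d \<delta> (\<Union>i\<in>I. A i)" for F
  proof -
    have "F = (\<Union>i\<in>I. F \<inter> A i)" using separated_subset[OF F] by blast
    then have "card F \<le> (\<Sum>i\<in>I. card (F \<inter> A i))"
      using card_UN_le[OF assms, of "\<lambda>i. F \<inter> A i"] by simp
    then have "of_nat (card F) \<le> (of_nat (\<Sum>i\<in>I. card (F \<inter> A i)) :: ennreal)"
      by (rule of_nat_mono)
    also have "\<dots> = (\<Sum>i\<in>I. of_nat (card (F \<inter> A i)))" by simp
    also have "\<dots> \<le> (\<Sum>i\<in>I. capC d \<delta> (A i))"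
      unfolding capC_eq_SUP_separated
      using F by (intro sum_mono SUP_upper) (auto simp: separated_def)
    finally show ?thesis .
  qed
  then show ?thesis unfolding capC_eq_SUP_separated[of d \<delta> "\<Union>i\<in>I. A i"] by (intro SUP_least)
qed

section \<open>Weighted capacities and upper semicontinuous envelopes\<close>

text \<open>The quantity \<open>P\<^sub>\<delta>(u)\<close> of the introduction.\<close>

definition wcap :: "real \<Rightarrow> ('a::metric_space \<Rightarrow> ennreal) \<Rightarrow> ennreal" where
  "wcap \<delta> u = (SUP F\<in>separated dist \<delta> UNIV. \<Sum>x\<in>F. u x)"

lemma wcap_mono: "(\<And>x. u x \<le> v x) \<Longrightarrow> wcap \<delta> u \<le> wcap \<delta> v"
  unfolding wcap_def by (intro SUP_mono) (auto intro!: bexI sum_mono)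

lemma wcap_indicator: "wcap \<delta> (indicator A) = capC dist \<delta> A"
proof (rule antisym)
  show "wcap \<delta> (indicator A) \<le> capC dist \<delta> A"
    unfolding wcap_def capC_eq_SUP_separated
  proof (rule SUP_mono)
    fix F :: "'a set" assume F: "F \<in> separated dist \<delta> UNIV"
    then have "F \<inter> A \<in> separated dist \<delta> A" by (auto simp: separated_def)
    moreover have "(\<Sum>x\<in>F. indicator A x) = (of_nat (card (F \<inter> A)) :: ennreal)"
      using separated_finite[OF F] by (simp add: indicator_def sum.If_cases Int_def)
    ultimately show "\<exists>G\<in>separated dist \<delta> A. (\<Sum>x\<in>F. indicator A x) \<le> (of_nat (card G) :: ennreal)"
      by (metis order_refl)
  qed
  show "capC dist \<delta> A \<le> wcap \<delta> (indicator A)"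
    unfolding wcap_def capC_eq_SUP_separated
  proof (rule SUP_mono)
    fix F assume F: "F \<in> separated dist \<delta> A"
    then have "(\<Sum>x\<in>F. indicator A x) = (\<Sum>x\<in>F. 1 :: ennreal)"
      by (intro sum.cong) (auto simp: separated_def)
    then show "\<exists>G\<in>separated dist \<delta> UNIV. of_nat (card F) \<le> (\<Sum>x\<in>G. indicator A x :: ennreal)"
      using F by (intro bexI[of _ F]) (auto simp: separated_def)
  qed
qed

text \<open>Separated subsets of the \<open>D i\<close> unite to one separated set, on whose
  \<open>i\<close>-th part \<open>u\<close> is at least \<open>c i\<close>. Positivity of
  \<open>\<delta>\<close> makes these parts disjoint, so that the sum splits.\<close>

lemma sum_capC_le_wcap:
  assumes "finite I"
    and sep: "\<And>i j x y. i \<in> I \<Longrightarrow> j \<in> I \<Longrightarrow> i \<noteq> j \<Longrightarrow> x \<in> D i \<Longrightarrow> y \<in> D j \<Longrightarrow> dist x y > \<delta>"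
    and u: "\<And>i x. i \<in> I \<Longrightarrow> x \<in> D i \<Longrightarrow> c i \<le> u x" and "\<delta> > 0"
  shows "(\<Sum>i\<in>I. c i * capC dist \<delta> (D i)) \<le> wcap \<delta> u"
  unfolding capC_eq_SUP_separated SUP_mult_left_ennreal
proof (rule sum_SUP_le[OF assms(1)])
  fix i show "separated dist \<delta> (D i) \<noteq> {}" using separated_empty by blast
next
  fix F assume F: "\<And>i. i \<in> I \<Longrightarrow> F i \<in> separated dist \<delta> (D i)"
  have disj: "F i \<inter> F j = {}" if "i \<in> I" "j \<in> I" "i \<noteq> j" for i j
    using sep[OF that] separated_subset[OF F[OF that(1)]] separated_subset[OF F[OF that(2)]] \<open>\<delta> > 0\<close>
    by fastforce
  have "(\<Union>i\<in>I. F i) \<in> separated dist \<delta> UNIV"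
  proof (rule separatedI)
    fix x y assume "x \<in> (\<Union>i\<in>I. F i)" "y \<in> (\<Union>i\<in>I. F i)" and ne: "x \<noteq> y"
    then obtain i j where ij: "i \<in> I" "x \<in> F i" "j \<in> I" "y \<in> F j" by auto
    show "\<delta> < dist x y"
    proof (cases "i = j")
      case True
      then show ?thesis using ij F separatedD ne by metis
    next
      case False
      then show ?thesis using sep ij separated_subset F by (metis subsetD)
    qed
  qed (use assms(1) separated_finite[OF F] in auto)
  moreover have "(\<Sum>i\<in>I. c i * of_nat (card (F i))) \<le> (\<Sum>x\<in>(\<Union>i\<in>I. F i). u x)"
  proof -
    have "(\<Sum>i\<in>I. c i * of_nat (card (F i))) = (\<Sum>i\<in>I. \<Sum>x\<in>F i. c i)"
      by (simp add: mult.commute)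
    also have "\<dots> \<le> (\<Sum>i\<in>I. \<Sum>x\<in>F i. u x)"
      using u separated_subset[OF F] by (intro sum_mono) blast
    also have "\<dots> = (\<Sum>x\<in>(\<Union>i\<in>I. F i). u x)"
      using assms(1) separated_finite[OF F] disj by (intro sum.UNION_disjoint[symmetric]) auto
    finally show ?thesis .
  qed
  ultimately show "(\<Sum>i\<in>I. c i * of_nat (card (F i))) \<le> wcap \<delta> u"
    unfolding wcap_def by (meson SUP_upper2)
qed

text \<open>The least upper semicontinuous majorant of \<open>u\<close>; the balls contain their
  centre, so that \<open>u x\<close> itself is counted.\<close>

definition usc_envelope :: "('a::metric_space \<Rightarrow> ennreal) \<Rightarrow> 'a \<Rightarrow> ennreal" where
  "usc_envelope u x = (INF e\<in>{0<..}. SUP y\<in>ball x e. u y)"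

lemma usc_envelope_ge: "u x \<le> usc_envelope u x"
  unfolding usc_envelope_def by (intro INF_greatest SUP_upper) auto

text \<open>A ball witnessing a value below \<open>s\<close> at \<open>x\<close> contains a smaller
  ball around each of its points, so strict sublevel sets are open.\<close>

lemma closed_usc_envelope_ge: "closed {x. s \<le> usc_envelope u x}"
proof -
  have "open {x. usc_envelope u x < s}"
  proof (rule openI)
    fix x assume "x \<in> {x. usc_envelope u x < s}"
    then obtain e where e: "e > 0" "(SUP y\<in>ball x e. u y) < s"
      unfolding usc_envelope_def by (auto simp: INF_less_iff)
    have "ball x e \<subseteq> {x. usc_envelope u x < s}"
    proof safe
      fix y assume y: "y \<in> ball x e"
      have "ball y (e - dist x y) \<subseteq> ball x e"
      proof
        fix z assume "z \<in> ball y (e - dist x y)"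
        then show "z \<in> ball x e" using dist_triangle[of x z y] by simp
      qed
      then have "usc_envelope u y \<le> (SUP z\<in>ball x e. u z)"
        unfolding usc_envelope_def using y
        by (intro INF_lower2[of "e - dist x y"] SUP_subset_mono) auto
      then show "usc_envelope u y < s" using e by simp
    qed
    then show "\<exists>T>0. ball x T \<subseteq> {x. usc_envelope u x < s}" using e by blast
  qed
  moreover have "{x. s \<le> usc_envelope u x} = - {x. usc_envelope u x < s}" by auto
  ultimately show ?thesis by (simp add: closed_def)
qed

text \<open>The finitely many distances in \<open>F\<close> exceed \<open>\<delta>\<close> by a
  common margin, so every point may be moved within a small ball to approach the supremum of
  \<open>u\<close> there without losing separation.\<close>

lemma wcap_usc_envelope_le: "wcap \<delta> (usc_envelope u) \<le> wcap \<delta> u"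
  unfolding wcap_def[of _ "usc_envelope u"]
proof (rule SUP_least)
  fix F :: "'a set" assume F: "F \<in> separated dist \<delta> UNIV"
  note fin = separated_finite[OF F]
  obtain \<eta> where \<eta>: "\<eta> > 0" "\<And>x y. x \<in> F \<Longrightarrow> y \<in> F \<Longrightarrow> x \<noteq> y \<Longrightarrow> dist x y > \<delta> + 2 * \<eta>"
    "\<And>x y. x \<in> F \<Longrightarrow> y \<in> F \<Longrightarrow> x \<noteq> y \<Longrightarrow> dist x y > 2 * \<eta>"
  proof -
    \<comment> \<open>The element 1 keeps the set nonempty when \<open>F\<close> has at most one
      point. The plain distance inside \<open>min\<close> makes the perturbation injective even for
      negative \<open>\<delta>\<close>.\<close>
    let ?S = "insert 1 ((\<lambda>(x, y). min (dist x y) (dist x y - \<delta>)) ` {(x, y). x \<in> F \<and> y \<in> F \<and> x \<noteq> y})"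
    have "finite {(x, y). x \<in> F \<and> y \<in> F \<and> x \<noteq> y}"
      by (rule finite_subset[of _ "F \<times> F"]) (use fin in auto)
    then have finS: "finite ?S" by simp
    have pos: "Min ?S > 0"
      using separatedD[OF F] by (subst Min_gr_iff[OF finS]) auto
    have "Min ?S \<le> min (dist x y) (dist x y - \<delta>)" if "x \<in> F" "y \<in> F" "x \<noteq> y" for x y
      using that by (intro Min_le[OF finS]) auto
    then show ?thesis
      using pos by (intro that[of "Min ?S / 3"]) (fastforce simp del: Min_insert)+
  qed
  have "(\<Sum>x\<in>F. usc_envelope u x) \<le> (\<Sum>x\<in>F. SUP y\<in>ball x \<eta>. u y)"
    unfolding usc_envelope_def using \<eta>(1) by (intro sum_mono INF_lower) auto
  also have "\<dots> \<le> wcap \<delta> u"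
  proof (rule sum_SUP_le[OF fin])
    fix x :: 'a show "ball x \<eta> \<noteq> {}" using \<eta>(1) by auto
  next
    fix f assume f: "\<And>x. x \<in> F \<Longrightarrow> f x \<in> ball x \<eta>"
    have tri: "dist x y \<le> dist (f x) (f y) + 2 * \<eta>" if "x \<in> F" "y \<in> F" for x y
      using f[OF that(1)] f[OF that(2)] dist_triangle[of x y "f x"] dist_triangle[of "f x" y "f y"]
      by (simp add: dist_commute)
    have inj: "inj_on f F"
      proof (rule inj_onI, rule ccontr)
      fix x y assume "x \<in> F" "y \<in> F" "f x = f y" "x \<noteq> y"
      then show False using tri[of x y] \<eta>(3)[of x y] by simp
    qed
    have "f ` F \<in> separated dist \<delta> UNIV"
    proof (rule separatedI)
      fix a b assume "a \<in> f ` F" "b \<in> f ` F" "a \<noteq> b"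
      then obtain x y where "x \<in> F" "y \<in> F" "a = f x" "b = f y" "x \<noteq> y" by auto
      then show "dist a b > \<delta>" using tri[of x y] \<eta>(2)[of x y] by simp
    qed (use fin in auto)
    then have "(\<Sum>x\<in>f ` F. u x) \<le> wcap \<delta> u"
      unfolding wcap_def by (intro SUP_upper)
    then show "(\<Sum>x\<in>F. u (f x)) \<le> wcap \<delta> u"
      by (simp add: sum.reindex[OF inj])
  qed
  finally show "(\<Sum>x\<in>F. usc_envelope u x) \<le> wcap \<delta> u" .
qed

text \<open>Taking the closure of a set amounts to taking the envelope of its indicator, which does
  not increase \<open>wcap\<close>.\<close>

lemma capC_closure: "capC dist \<delta> (closure A) = capC dist \<delta> A"
proof (rule antisym)
  have "indicator (closure A) x \<le> usc_envelope (indicator A) x" for x :: 'a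
  proof (cases "x \<in> closure A")
    case True
    show ?thesis
      unfolding usc_envelope_def
    proof (rule INF_greatest)
      fix e :: real assume "e \<in> {0<..}"
      then obtain y where "y \<in> A" "dist y x < e"
        using True by (auto simp: closure_approachable)
      then show "indicator (closure A) x \<le> (SUP y\<in>ball x e. indicator A y :: ennreal)"
        using True by (intro SUP_upper2[of y]) (auto simp: dist_commute)
    qed
  qed auto
  then have "wcap \<delta> (indicator (closure A)) \<le> wcap \<delta> (indicator A)"
    using wcap_mono wcap_usc_envelope_le by (metis order_trans)
  then show "capC dist \<delta> (closure A) \<le> capC dist \<delta> A" by (simp add: wcap_indicator)
qed (simp add: capC_mono closure_subset)

section \<open>Box contents and the measures derived from them\<close>

lemma upper_box0_mono: "A \<subseteq> B \<Longrightarrow> upper_box0 d h A \<le> upper_box0 d h B"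
  unfolding upper_box0_def by (intro Limsup_mono always_eventually allI mult_right_mono capC_mono) auto

lemma lower_box0_mono: "A \<subseteq> B \<Longrightarrow> lower_box0 d h A \<le> lower_box0 d h B"
  unfolding lower_box0_def by (intro Liminf_mono always_eventually allI mult_right_mono capC_mono) auto

lemma upper_box0_empty: "upper_box0 d h {} = 0"
  unfolding upper_box0_def by (simp add: Limsup_const)

lemma lower_box0_empty: "lower_box0 d h {} = 0"
  unfolding lower_box0_def by (simp add: Liminf_const)

lemma upper_box0_closure: "upper_box0 dist h (closure A) = upper_box0 dist h A"
  by (simp add: upper_box0_def capC_closure)

text \<open>Subadditivity of \<open>capC\<close> survives an upper limit. It need not survive a
  lower one, where the pieces can be small at different scales.\<close>

lemma upper_box0_UN_le:
  assumes "finite I"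
  shows "upper_box0 d h (\<Union>i\<in>I. A i) \<le> (\<Sum>i\<in>I. upper_box0 d h (A i))"
proof -
  have "upper_box0 d h (\<Union>i\<in>I. A i) \<le> Limsup (at_right 0) (\<lambda>\<delta>. \<Sum>i\<in>I. capC d \<delta> (A i) * ennreal (h \<delta>))"
    unfolding upper_box0_def sum_distrib_right[symmetric]
    by (intro Limsup_mono always_eventually allI mult_right_mono capC_UN_le assms) auto
  also have "\<dots> \<le> (\<Sum>i\<in>I. upper_box0 d h (A i))"
    unfolding upper_box0_def by (rule Limsup_sum_le[OF assms])
  finally show ?thesis .
qed

lemma hat_le:
  assumes "\<tau> {} = 0"
  shows "hat \<tau> E \<le> \<tau> E"
proof -
  let ?A = "\<lambda>n::nat. if n = 0 then E else {}"
  have "hat \<tau> E \<le> (\<Sum>n. \<tau> (?A n))"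
    unfolding hat_def by (rule INF_lower) (auto split: if_splits)
  also have "\<dots> = (\<Sum>n\<in>{0}. \<tau> (?A n))"
    using assms by (intro suminf_finite) auto
  finally show ?thesis by simp
qed

lemma sets_borel_restr: "sets (borel_restr \<mu>) = sets borel"
  unfolding borel_restr_def by (simp add: sets_measure_of_conv) (metis sets.sigma_sets_eq space_borel)

text \<open>\<^const>\<open>measure_of\<close> yields the null measure when the set function is not countably additive on the
  Borel sets. This does happen for the upper box measure: two Cantor sets at positive distance can
  be large at complementary scales.\<close>

lemma emeasure_borel_restr_cases:
  obtains "\<And>A. A \<in> sets borel \<Longrightarrow> emeasure (borel_restr \<mu>) A = \<mu> A"
  | "\<And>A. emeasure (borel_restr \<mu>) A = 0"
proof (cases "measure_space UNIV (sigma_sets UNIV (sets borel)) \<mu>")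
  case True
  moreover have "A \<in> sigma_sets UNIV (sets borel)" if "A \<in> sets borel" for A :: "'a set"
    using that by (rule sigma_sets.Basic)
  ultimately show ?thesis
    using that(1) unfolding borel_restr_def by (simp add: emeasure_measure_of_conv)
next
  case False
  then show ?thesis
    using that(2) unfolding borel_restr_def by (simp add: emeasure_measure_of_conv)
qed

section \<open>Integrals of functions with closed superlevel sets\<close>

text \<open>Rounding \<open>v\<close> down to finitely many values gives level sets that are
  differences of closed sets. Each is exhausted by closed pieces staying away from the higher
  levels, and finitely many such pieces have a common positive distance. Hence \<open>L\<close> has
  to be checked on separated pieces only.\<close>

lemma nn_integral_le_if_closed_levels:
  fixes v :: "'a::metric_space \<Rightarrow> ennreal"
  assumes sets: "sets M = sets borel"
    and cl: "\<And>s. closed {x. s \<le> v x}"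
    and L: "\<And>V D r. finite V \<Longrightarrow> r > 0 \<Longrightarrow> (\<And>c. c \<in> V \<Longrightarrow> c < top) \<Longrightarrow> (\<And>c. c \<in> V \<Longrightarrow> D c \<in> sets borel) \<Longrightarrow>
      (\<And>c x. c \<in> V \<Longrightarrow> x \<in> D c \<Longrightarrow> c \<le> v x) \<Longrightarrow>
      (\<And>c c' x y. c \<in> V \<Longrightarrow> c' \<in> V \<Longrightarrow> c \<noteq> c' \<Longrightarrow> x \<in> D c \<Longrightarrow> y \<in> D c' \<Longrightarrow> r \<le> dist x y) \<Longrightarrow>
      (\<Sum>c\<in>V. c * emeasure M (D c)) \<le> L"
  shows "integral\<^sup>N M v \<le> L"
  \<comment> \<open>Only simple functions with finite values are tested, which is where
    \<open>c < top\<close> in the hypothesis on \<open>L\<close> comes from.\<close>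
  unfolding nn_integral_def_finite
proof (rule SUP_least, safe)
  fix g assume g: "simple_function M g" "g \<le> v" "\<forall>x. g x < top"
  have space: "space M = UNIV" using sets_eq_imp_space_eq[OF sets] by simp
  define V where "V = range g"
  have fV: "finite V" using g(1) space by (auto simp: V_def simple_function_def)
  define K where "K c = (\<Union>w\<in>{w\<in>V. c < w}. {x. w \<le> v x})" for c
  have clK: "closed (K c)" for c
    unfolding K_def using fV cl by (intro closed_UN) auto
  \<comment> \<open>The difference of the level set and \<open>K c\<close> need not be closed; the
    part at distance at least \<open>1 / real (Suc n)\<close> from \<open>K c\<close> is closed and
    increases to it.\<close>
  define D where "D n c = {x. c \<le> v x} \<inter> (\<Inter>y\<in>K c. {x. 1 / real (Suc n) \<le> dist x y})" for n c
  have D_closed: "closed (D n c)" for n c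
    unfolding D_def by (intro closed_Int cl closed_INT ballI closed_Collect_le continuous_intros)
  then have D_sets[measurable]: "D n c \<in> sets M" for n c
    using sets by simp
  have D_inc: "incseq (\<lambda>n. D n c)" for c
  proof (rule incseq_SucI)
    fix n
    have "1 / real (Suc (Suc n)) \<le> 1 / real (Suc n)" by (simp add: field_simps)
    then show "D n c \<le> D (Suc n) c" unfolding D_def by fastforce
  qed
  have D_UN: "(\<Union>n. D n c) = {x. c \<le> v x} - K c" for c
  proof (intro equalityI subsetI)
    fix x assume "x \<in> (\<Union>n. D n c)"
    then obtain n where n: "c \<le> v x" "\<And>y. y \<in> K c \<Longrightarrow> 1 / real (Suc n) \<le> dist x y" by (auto simp: D_def)
    then show "x \<in> {x. c \<le> v x} - K c" using n(2)[of x] by (auto simp: field_simps)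
  next
    fix x assume x: "x \<in> {x. c \<le> v x} - K c"
    then obtain e where e: "e > 0" "\<forall>y. dist y x < e \<longrightarrow> y \<in> - K c"
      using clK[of c] unfolding closed_def open_dist by auto
    obtain n where "1 / real (Suc n) < e" using nat_approx_posE[OF e(1)] by auto
    then have "1 / real (Suc n) \<le> dist x y" if "y \<in> K c" for y
      using e(2) that by (smt (verit) ComplD dist_commute)
    then show "x \<in> (\<Union>n. D n c)" using x by (auto simp: D_def)
  qed
  have "integral\<^sup>S M g = (\<integral>\<^sup>+x. g x \<partial>M)"
    using g by (simp add: nn_integral_eq_simple_integral)
  also have "\<dots> \<le> (\<integral>\<^sup>+x. (\<Sum>c\<in>V. c * indicator (\<Union>n. D n c) x) \<partial>M)"
  proof (rule nn_integral_mono)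
    fix x
    \<comment> \<open>The level sets of \<open>g\<close> are merely measurable. Replacing
      \<open>g x\<close> by the largest element of \<open>V\<close> below \<open>v x\<close> only
      increases it and has differences of closed sets as levels.\<close>
    let ?S = "{c\<in>V. c \<le> v x}"
    have S: "finite ?S" "g x \<in> ?S" using fV g(2) by (auto simp: V_def le_fun_def)
    have mS: "Max ?S \<in> ?S" using S by (intro Max_in) auto
    have "g x \<le> Max ?S" using S by (intro Max_ge)
    also have "x \<notin> K (Max ?S)"
    proof
      assume "x \<in> K (Max ?S)"
      then obtain w where "w \<in> ?S" "Max ?S < w" by (auto simp: K_def)
      then show False using Max_ge[OF S(1)] leD by blast
    qed
    then have "Max ?S = Max ?S * indicator (\<Union>n. D n (Max ?S)) x"
      using mS unfolding D_UN by (auto simp: indicator_def)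
    also have "\<dots> \<le> (\<Sum>c\<in>V. c * indicator (\<Union>n. D n c) x)"
      using mS fV by (intro member_le_sum) auto
    finally show "g x \<le> (\<Sum>c\<in>V. c * indicator (\<Union>n. D n c) x)" .
  qed
  also have "\<dots> = (\<Sum>c\<in>V. c * emeasure M (\<Union>n. D n c))"
    by (subst nn_integral_sum) (auto intro!: sum.cong nn_integral_cmult_indicator)
  also have "\<dots> = (\<Sum>c\<in>V. SUP n\<in>UNIV. c * emeasure M (D n c))"
    using D_inc by (simp add: SUP_emeasure_incseq[symmetric] image_subset_iff SUP_mult_left_ennreal)
  also have "\<dots> \<le> L"
  proof (rule sum_SUP_le[OF fV])
    fix f :: "ennreal \<Rightarrow> nat"
    \<comment> \<open>The smallest of the finitely many distances belonging to the chosen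
      indices.\<close>
    define r where "r = 1 / real (Suc (Max (insert 0 (f ` V))))"
    have r: "r > 0" "c \<in> V \<Longrightarrow> r \<le> 1 / real (Suc (f c))" for c
      using fV by (auto simp: r_def simp del: Max_insert intro!: divide_left_mono Max_ge)
    \<comment> \<open>The piece of the higher value \<open>c'\<close> lies inside
      \<open>K c\<close>, so the distance is guaranteed by the piece of the lower value.\<close>
    have *: "r \<le> dist x y" if "c \<in> V" "c' \<in> V" "c < c'" "x \<in> D (f c) c" "y \<in> D (f c') c'" for c c' x y
    proof -
      have "y \<in> K c" using that by (auto simp: K_def D_def)
      then show ?thesis using that(4) r(2)[OF that(1)] by (force simp: D_def)
    qed
    show "(\<Sum>c\<in>V. c * emeasure M (D (f c) c)) \<le> L"
    proof (rule L[OF fV r(1)])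
      show "c < top" if "c \<in> V" for c using g(3) that by (auto simp: V_def)
      show "D (f c) c \<in> sets borel" for c using D_sets sets by simp
      show "c \<le> v x" if "x \<in> D (f c) c" for c x using that by (auto simp: D_def)
      show "r \<le> dist x y" if "c \<in> V" "c' \<in> V" "c \<noteq> c'" "x \<in> D (f c) c" "y \<in> D (f c') c'" for c c' x y
        using *[of c c' x y] *[of c' c y x] that by (cases c c' rule: linorder_cases) (auto simp: dist_commute)
    qed
  qed simp
  finally show "integral\<^sup>S M g \<le> L" .
qed

section \<open>Bounds for weighted sums over pieces at positive distance\<close>

text \<open>At scales \<open>\<delta> < r\<close> the pieces are more than \<open>\<delta>\<close>
  apart.\<close>

lemma eventually_sum_capC_le_wcap:
  assumes "finite I" and "r > 0"
    and sep: "\<And>i j x y. i \<in> I \<Longrightarrow> j \<in> I \<Longrightarrow> i \<noteq> j \<Longrightarrow> x \<in> D i \<Longrightarrow> y \<in> D j \<Longrightarrow> r \<le> dist x y"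
    and u: "\<And>i x. i \<in> I \<Longrightarrow> x \<in> D i \<Longrightarrow> c i \<le> u x"
  shows "\<forall>\<^sub>F \<delta> in at_right 0.
    (\<Sum>i\<in>I. c i * (capC dist \<delta> (D i) * ennreal (h \<delta>))) \<le> wcap \<delta> u * ennreal (h \<delta>)"
  using eventually_at_right_real[OF \<open>r > 0\<close>]
proof eventually_elim
  case (elim \<delta>)
  have "(\<Sum>i\<in>I. c i * capC dist \<delta> (D i)) \<le> wcap \<delta> u"
  proof (rule sum_capC_le_wcap[OF \<open>finite I\<close> _ u])
    show "\<delta> < dist x y" if "i \<in> I" "j \<in> I" "i \<noteq> j" "x \<in> D i" "y \<in> D j" for i j x y
      using sep[OF that] elim by simp
  qed (use elim in auto)
  then have "(\<Sum>i\<in>I. c i * capC dist \<delta> (D i)) * ennreal (h \<delta>) \<le> wcap \<delta> u * ennreal (h \<delta>)"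
    by (rule mult_right_mono) auto
  then show ?case by (simp add: sum_distrib_right mult.assoc)
qed

text \<open>Lower limits are superadditive, so the bound at each small scale passes directly to the
  limit.\<close>

lemma sum_lower_box_le_Liminf_wcap:
  assumes "finite I" and "r > 0"
    and "\<And>i j x y. i \<in> I \<Longrightarrow> j \<in> I \<Longrightarrow> i \<noteq> j \<Longrightarrow> x \<in> D i \<Longrightarrow> y \<in> D j \<Longrightarrow> r \<le> dist x y"
    and "\<And>i x. i \<in> I \<Longrightarrow> x \<in> D i \<Longrightarrow> c i \<le> u x"
  shows "(\<Sum>i\<in>I. c i * lower_box dist h (D i)) \<le> Liminf (at_right 0) (\<lambda>\<delta>. wcap \<delta> u * ennreal (h \<delta>))"
proof -
  have "(\<Sum>i\<in>I. c i * lower_box dist h (D i)) \<le> (\<Sum>i\<in>I. c i * lower_box0 dist h (D i))"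
    unfolding lower_box_def by (intro sum_mono mult_left_mono hat_le lower_box0_empty) auto
  also have "\<dots> \<le> (\<Sum>i\<in>I. Liminf (at_right 0) (\<lambda>\<delta>. c i * (capC dist \<delta> (D i) * ennreal (h \<delta>))))"
    unfolding lower_box0_def by (intro sum_mono mult_Liminf_le)
  also have "\<dots> \<le> Liminf (at_right 0) (\<lambda>\<delta>. \<Sum>i\<in>I. c i * (capC dist \<delta> (D i) * ennreal (h \<delta>)))"
    by (rule sum_Liminf_le[OF assms(1)])
  also have "\<dots> \<le> Liminf (at_right 0) (\<lambda>\<delta>. wcap \<delta> u * ennreal (h \<delta>))"
    using assms by (intro Liminf_mono eventually_sum_capC_le_wcap)
  finally show ?thesis .
qed

text \<open>Closing the members of an almost optimal cover costs no content and makes them Borel. By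
  continuity from below finitely many of them carry almost all of the measure of \<open>D\<close>,
  and on that part finite subadditivity bounds the content.\<close>

lemma upper_box_approx:
  fixes D :: "'a::metric_space set"
  assumes sets: "sets M = sets borel"
    and M: "\<And>A. A \<in> sets borel \<Longrightarrow> emeasure M A = upper_box dist h A"
    and D: "D \<in> sets borel" and fin: "emeasure M D < top" and e: "0 < (e::ennreal)"
  obtains D' where "D' \<in> sets borel" "D' \<subseteq> D" "upper_box0 dist h D' \<le> emeasure M D + e"
    "emeasure M D \<le> emeasure M D' + e"
proof -
  have "hat (upper_box0 dist h) D < emeasure M D + e"
    using fin e D M by (simp add: ennreal_add_left_cancel_less less_top upper_box_def)
  then obtain A :: "nat \<Rightarrow> 'a set" where A: "D \<subseteq> (\<Union>n. A n)" "(\<Sum>n. upper_box0 dist h (A n)) < emeasure M D + e"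
    unfolding hat_def by (auto simp: INF_less_iff)
  define B where "B n = D \<inter> (\<Union>j\<in>{..<n}. closure (A j))" for n
  have B_sets: "B n \<in> sets borel" for n
    unfolding B_def using D by (intro sets.Int sets.finite_UN) auto
  have "incseq B" unfolding B_def by (force simp: incseq_def)
  moreover have "(\<Union>n. B n) = D"
  proof (intro equalityI subsetI)
    fix x assume x: "x \<in> D"
    then obtain n where "x \<in> A n" using A(1) by blast
    then have "x \<in> closure (A n)" using closure_subset by blast
    then have "x \<in> B (Suc n)" using x by (auto simp: B_def)
    then show "x \<in> (\<Union>n. B n)" by blast
  qed (auto simp: B_def)
  ultimately have "(SUP n. emeasure M (B n)) = emeasure M D"
    using B_sets sets by (subst SUP_emeasure_incseq) auto
  then have "emeasure M D < (SUP n. emeasure M (B n) + e)"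
    using fin e by (simp add: ennreal_SUP_add_left ennreal_add_left_cancel_less less_top)
  then obtain n where n: "emeasure M D < emeasure M (B n) + e"
    by (auto simp: less_SUP_iff)
  have "upper_box0 dist h (B n) \<le> upper_box0 dist h (\<Union>j\<in>{..<n}. closure (A j))"
    unfolding B_def by (rule upper_box0_mono) auto
  also have "\<dots> \<le> (\<Sum>j\<in>{..<n}. upper_box0 dist h (closure (A j)))"
    by (rule upper_box0_UN_le) auto
  also have "\<dots> = (\<Sum>j\<in>{..<n}. upper_box0 dist h (A j))"
    by (simp add: upper_box0_closure)
  also have "\<dots> \<le> (\<Sum>n. upper_box0 dist h (A n))"
    by (rule sum_le_suminf) auto
  finally have "upper_box0 dist h (B n) \<le> emeasure M D + e" using A(2) by simp
  then show ?thesis using that[of "B n"] B_sets n by (auto simp: B_def)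
qed

text \<open>Upper limits are only subadditive, so the complementary weights \<open>C - c i\<close>
  are used. The content with constant weight \<open>C\<close> is bounded below by additivity of
  \<open>M\<close>, the part with weights \<open>C - c i\<close> is bounded above by near-optimality
  of the pieces, and the difference is what remains for the weights \<open>c i\<close>.\<close>

lemma sum_upper_box_le_Limsup_wcap_finite:
  fixes D :: "'i \<Rightarrow> 'a::metric_space set"
  assumes sets: "sets M = sets borel"
    and M: "\<And>A. A \<in> sets borel \<Longrightarrow> emeasure M A = upper_box dist h A"
    and I: "finite I" and r: "r > 0"
    and D: "\<And>i. i \<in> I \<Longrightarrow> D i \<in> sets borel" "\<And>i. i \<in> I \<Longrightarrow> emeasure M (D i) < top"
    and c: "\<And>i. i \<in> I \<Longrightarrow> c i < top"
    and sep: "\<And>i j x y. i \<in> I \<Longrightarrow> j \<in> I \<Longrightarrow> i \<noteq> j \<Longrightarrow> x \<in> D i \<Longrightarrow> y \<in> D j \<Longrightarrow> r \<le> dist x y"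
    and u: "\<And>i x. i \<in> I \<Longrightarrow> x \<in> D i \<Longrightarrow> c i \<le> u x"
  shows "(\<Sum>i\<in>I. c i * emeasure M (D i)) \<le> Limsup (at_right 0) (\<lambda>\<delta>. wcap \<delta> u * ennreal (h \<delta>))"
    (is "_ \<le> ?L")
proof -
  \<comment> \<open>Any finite common upper bound of the \<open>c i\<close> would serve.\<close>
  define C where "C = (\<Sum>i\<in>I. c i)"
  define m where "m i = emeasure M (D i)" for i
  have C: "C < top" unfolding C_def using c I by (simp add: less_top)
  have Cc: "c i + (C - c i) = C" if "i \<in> I" for i
    unfolding C_def using that I by (intro add_diff_inverse_ennreal member_le_sum) auto
  define S where "S = (\<Sum>i\<in>I. (C - c i) * m i)"
  have S: "S < top"
    unfolding S_def m_def using D(2) C I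
    by (auto simp: ennreal_mult_less_top intro: le_less_trans[OF diff_le_self_ennreal])
  \<comment> \<open>One error term comes from the measure lost in passing to \<open>D'\<close>, the
    other from the excess of the content of \<open>D'\<close> over \<open>m\<close>.\<close>
  have main: "(\<Sum>i\<in>I. c i * m i) \<le> ?L + ennreal e * (C * of_nat (card I) + C * of_nat (card I))" if e: "e > 0" for e
  proof -
    have "\<exists>D'. D' \<in> sets borel \<and> D' \<subseteq> D i \<and> upper_box0 dist h D' \<le> m i + ennreal e \<and> m i \<le> emeasure M D' + ennreal e"
      if "i \<in> I" for i
      unfolding m_def using upper_box_approx[OF sets M D(1)[OF that] D(2)[OF that], of "ennreal e"] e by (metis ennreal_less_zero_iff)
    then obtain D' where D': "\<And>i. i \<in> I \<Longrightarrow> D' i \<in> sets borel" "\<And>i. i \<in> I \<Longrightarrow> D' i \<subseteq> D i"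
      "\<And>i. i \<in> I \<Longrightarrow> upper_box0 dist h (D' i) \<le> m i + ennreal e" "\<And>i. i \<in> I \<Longrightarrow> m i \<le> emeasure M (D' i) + ennreal e"
      by metis
    define a where "a i \<delta> = capC dist \<delta> (D' i) * ennreal (h \<delta>)" for i \<delta>
    have disj: "disjoint_family_on D' I"
      unfolding disjoint_family_on_def
    proof (intro ballI impI, rule ccontr)
      fix i j assume ij: "i \<in> I" "j \<in> I" "i \<noteq> j" "D' i \<inter> D' j \<noteq> {}"
      then obtain x where "x \<in> D i" "x \<in> D j" using D'(2) by blast
      then show False using sep[of i j x x] ij r by simp
    qed
    have "emeasure M (\<Union>i\<in>I. D' i) = upper_box dist h (\<Union>i\<in>I. D' i)"
      using D'(1) I by (intro M sets.finite_UN) auto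
    also have "\<dots> \<le> upper_box0 dist h (\<Union>i\<in>I. D' i)"
      unfolding upper_box_def by (intro hat_le upper_box0_empty)
    finally have "C * emeasure M (\<Union>i\<in>I. D' i) \<le> C * upper_box0 dist h (\<Union>i\<in>I. D' i)"
      by (rule mult_left_mono) auto
    also have "\<dots> \<le> ?L + (\<Sum>i\<in>I. (C - c i) * (m i + ennreal e))"
    proof -
      have "C * upper_box0 dist h (\<Union>i\<in>I. D' i) \<le> Limsup (at_right 0) (\<lambda>\<delta>. C * (capC dist \<delta> (\<Union>i\<in>I. D' i) * ennreal (h \<delta>)))"
        unfolding upper_box0_def using C by (subst Limsup_cmult_ennreal) auto
      also have "\<dots> \<le> Limsup (at_right 0) (\<lambda>\<delta>. wcap \<delta> u * ennreal (h \<delta>) + (\<Sum>i\<in>I. (C - c i) * a i \<delta>))"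
      proof (rule Limsup_mono)
        have "\<forall>\<^sub>F \<delta> in at_right 0. (\<Sum>i\<in>I. c i * a i \<delta>) \<le> wcap \<delta> u * ennreal (h \<delta>)"
          unfolding a_def using D'(2) sep u by (intro eventually_sum_capC_le_wcap[OF I r]) blast+
        then show "\<forall>\<^sub>F \<delta> in at_right 0. C * (capC dist \<delta> (\<Union>i\<in>I. D' i) * ennreal (h \<delta>))
            \<le> wcap \<delta> u * ennreal (h \<delta>) + (\<Sum>i\<in>I. (C - c i) * a i \<delta>)"
        proof eventually_elim
          case (elim \<delta>)
          have "C * (capC dist \<delta> (\<Union>i\<in>I. D' i) * ennreal (h \<delta>)) \<le> C * ((\<Sum>i\<in>I. capC dist \<delta> (D' i)) * ennreal (h \<delta>))"
            by (intro mult_left_mono mult_right_mono capC_UN_le I) auto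
          also have "\<dots> = (\<Sum>i\<in>I. C * a i \<delta>)"
            by (simp add: a_def sum_distrib_left sum_distrib_right)
          also have "\<dots> = (\<Sum>i\<in>I. (c i + (C - c i)) * a i \<delta>)"
            by (intro sum.cong) (simp_all only: Cc)
          also have "\<dots> = (\<Sum>i\<in>I. c i * a i \<delta>) + (\<Sum>i\<in>I. (C - c i) * a i \<delta>)"
            by (simp add: distrib_right sum.distrib)
          also have "\<dots> \<le> wcap \<delta> u * ennreal (h \<delta>) + (\<Sum>i\<in>I. (C - c i) * a i \<delta>)"
            using elim by (rule add_right_mono)
          finally show ?case .
        qed
      qed
      also have "\<dots> \<le> ?L + Limsup (at_right 0) (\<lambda>\<delta>. \<Sum>i\<in>I. (C - c i) * a i \<delta>)"
        by (rule Limsup_add_le)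
      also have "\<dots> \<le> ?L + (\<Sum>i\<in>I. (C - c i) * (m i + ennreal e))"
      proof (rule add_left_mono)
        have "Limsup (at_right 0) (\<lambda>\<delta>. \<Sum>i\<in>I. (C - c i) * a i \<delta>)
          \<le> (\<Sum>i\<in>I. Limsup (at_right 0) (\<lambda>\<delta>. (C - c i) * a i \<delta>))"
          by (rule Limsup_sum_le[OF I])
        also have "\<dots> = (\<Sum>i\<in>I. (C - c i) * upper_box0 dist h (D' i))"
          unfolding upper_box0_def a_def using C
          by (intro sum.cong Limsup_cmult_ennreal) (auto intro: le_less_trans[OF diff_le_self_ennreal])
        also have "\<dots> \<le> (\<Sum>i\<in>I. (C - c i) * (m i + ennreal e))"
          using D'(3) by (intro sum_mono mult_left_mono) auto
        finally show "Limsup (at_right 0) (\<lambda>\<delta>. \<Sum>i\<in>I. (C - c i) * a i \<delta>) \<le> (\<Sum>i\<in>I. (C - c i) * (m i + ennreal e))" .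
      qed
      finally show ?thesis .
    qed
    \<comment> \<open>Additivity of \<open>M\<close> enters here: it excludes pieces that are large
      only at different scales.\<close>
    also have "emeasure M (\<Union>i\<in>I. D' i) = (\<Sum>i\<in>I. emeasure M (D' i))"
      using D'(1) sets disj I by (intro sum_emeasure[symmetric]) auto
    finally have *: "C * (\<Sum>i\<in>I. emeasure M (D' i)) \<le> ?L + (\<Sum>i\<in>I. (C - c i) * (m i + ennreal e))" .
    \<comment> \<open>Adding \<open>S\<close> completes every weight to \<open>C\<close> and avoids
      subtraction in \<open>ennreal\<close>; being finite, \<open>S\<close> is cancelled at the
      end.\<close>
    have "S + (\<Sum>i\<in>I. c i * m i) = (\<Sum>i\<in>I. (c i + (C - c i)) * m i)"
      by (simp add: S_def distrib_right sum.distrib add.commute)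
    also have "\<dots> = C * (\<Sum>i\<in>I. m i)"
      unfolding sum_distrib_left by (intro sum.cong) (simp_all only: Cc)
    also have "\<dots> \<le> C * (\<Sum>i\<in>I. emeasure M (D' i) + ennreal e)"
      using D'(4) by (intro mult_left_mono sum_mono) auto
    also have "\<dots> = C * (\<Sum>i\<in>I. emeasure M (D' i)) + ennreal e * (C * of_nat (card I))"
      by (simp add: sum.distrib distrib_left mult_ac)
    also have "\<dots> \<le> ?L + (\<Sum>i\<in>I. (C - c i) * (m i + ennreal e)) + ennreal e * (C * of_nat (card I))"
      by (rule add_right_mono[OF *])
    also have "(\<Sum>i\<in>I. (C - c i) * (m i + ennreal e)) = S + (\<Sum>i\<in>I. (C - c i) * ennreal e)"
      by (simp add: S_def distrib_left sum.distrib)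
    also have "?L + (S + (\<Sum>i\<in>I. (C - c i) * ennreal e)) + ennreal e * (C * of_nat (card I))
      \<le> ?L + (S + (\<Sum>i\<in>I. C * ennreal e)) + ennreal e * (C * of_nat (card I))"
      by (intro add_left_mono add_right_mono sum_mono mult_right_mono diff_le_self_ennreal) auto
    also have "\<dots> = S + (?L + ennreal e * (C * of_nat (card I) + C * of_nat (card I)))"
      by (simp add: distrib_left mult_ac add_ac)
    finally show ?thesis using S by (auto simp: ennreal_add_left_cancel_le)
  qed
  show ?thesis unfolding m_def[symmetric]
  proof (rule ennreal_le_epsilon)
    fix e :: real assume e: "0 < e"
    have "C * of_nat (card I) + C * of_nat (card I) < top"
      using C by (simp add: ennreal_mult_less_top of_nat_less_top)
    then obtain k where k: "k \<ge> 0" "C * of_nat (card I) + C * of_nat (card I) = ennreal k"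
      by (metis ennreal_cases less_irrefl)
    \<comment> \<open>The denominator is \<open>k + 1\<close> because \<open>k\<close> may be
      0.\<close>
    have "(\<Sum>i\<in>I. c i * m i) \<le> ?L + ennreal (e / (k + 1)) * ennreal k"
      using main[of "e / (k + 1)"] e k by simp
    also have "ennreal (e / (k + 1)) * ennreal k = ennreal (e / (k + 1) * k)"
      using e k by (intro ennreal_mult'[symmetric]) simp
    also have "?L + \<dots> \<le> ?L + ennreal e"
      using e k by (intro add_left_mono ennreal_leI) (simp add: field_simps)
    finally show "(\<Sum>i\<in>I. c i * m i) \<le> ?L + ennreal e" .
  qed
qed

text \<open>A piece of infinite measure and nonzero weight makes the right-hand side infinite on its
  own; infinite pieces of weight 0 contribute nothing and are dropped.\<close>

lemma sum_upper_box_le_Limsup_wcap: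
  fixes D :: "'i \<Rightarrow> 'a::metric_space set"
  assumes sets: "sets M = sets borel"
    and M: "\<And>A. A \<in> sets borel \<Longrightarrow> emeasure M A = upper_box dist h A"
    and I: "finite I" and r: "r > 0"
    and D: "\<And>i. i \<in> I \<Longrightarrow> D i \<in> sets borel"
    and c: "\<And>i. i \<in> I \<Longrightarrow> c i < top"
    and sep: "\<And>i j x y. i \<in> I \<Longrightarrow> j \<in> I \<Longrightarrow> i \<noteq> j \<Longrightarrow> x \<in> D i \<Longrightarrow> y \<in> D j \<Longrightarrow> r \<le> dist x y"
    and u: "\<And>i x. i \<in> I \<Longrightarrow> x \<in> D i \<Longrightarrow> c i \<le> u x"
  shows "(\<Sum>i\<in>I. c i * emeasure M (D i)) \<le> Limsup (at_right 0) (\<lambda>\<delta>. wcap \<delta> u * ennreal (h \<delta>))"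
    (is "_ \<le> ?L")
proof (cases "\<exists>i\<in>I. c i \<noteq> 0 \<and> emeasure M (D i) = top")
  case True
  then obtain i where i: "i \<in> I" "c i \<noteq> 0" "emeasure M (D i) = top" by blast
  have "emeasure M (D i) \<le> upper_box0 dist h (D i)"
    using M[OF D[OF i(1)]] hat_le[of "upper_box0 dist h" "D i"] upper_box0_empty[of dist h]
    by (simp add: upper_box_def)
  then have "c i * upper_box0 dist h (D i) = top"
    using i by (simp add: top_unique ennreal_mult_top)
  then have "top \<le> Limsup (at_right 0) (\<lambda>\<delta>. c i * (capC dist \<delta> (D i) * ennreal (h \<delta>)))"
    unfolding upper_box0_def using c[OF i(1)] by (subst Limsup_cmult_ennreal) auto
  also have "\<dots> \<le> ?L"
    using eventually_sum_capC_le_wcap[of "{i}" r D c u h] r u[OF i(1)] by (intro Limsup_mono) auto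
  finally show ?thesis by (simp add: top_unique)
next
  case False
  let ?J = "{i\<in>I. emeasure M (D i) < top}"
  have "(\<Sum>i\<in>I. c i * emeasure M (D i)) = (\<Sum>i\<in>?J. c i * emeasure M (D i))"
    using I False by (intro sum.mono_neutral_right) (auto simp: less_top)
  also have "\<dots> \<le> ?L"
    using I D c sep u by (intro sum_upper_box_le_Limsup_wcap_finite[OF sets M _ r]) auto
  finally show ?thesis .
qed

section \<open>Upper integrals\<close>

lemma borel_measurable_usc_envelope:
  assumes "sets M = sets borel"
  shows "usc_envelope u \<in> borel_measurable M"
proof (rule borel_measurableI_ge)
  fix s
  have "{x \<in> space M. s \<le> usc_envelope u x} = {x. s \<le> usc_envelope u x}"
    using sets_eq_imp_space_eq[OF assms] by simp
  also have "\<dots> \<in> sets M"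
    unfolding assms by (rule borel_closed[OF closed_usc_envelope_ge])
  finally show "{x \<in> space M. s \<le> usc_envelope u x} \<in> sets M" .
qed

lemma upper_integral_le_usc_envelope:
  assumes "sets M = sets borel"
  shows "upper_integral M u \<le> integral\<^sup>N M (usc_envelope u)"
  unfolding upper_integral_def
  using borel_measurable_usc_envelope[OF assms] usc_envelope_ge by (intro INF_lower) auto

text \<open>The envelope is a Borel majorant with closed superlevel sets and the same
  \<open>wcap\<close> bound, so its integral can be estimated on separated pieces. Should
  \<open>borel_restr\<close> give the null measure, the sums vanish.\<close>

lemma upper_integral_le_Limsup_wcap:
  fixes u :: "'a::metric_space \<Rightarrow> ennreal"
  shows "upper_integral (borel_restr (upper_box dist h)) u \<le> Limsup (at_right 0) (\<lambda>\<delta>. wcap \<delta> u * ennreal (h \<delta>))"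
proof -
  let ?M = "borel_restr (upper_box dist h) :: 'a measure"
  have "integral\<^sup>N ?M (usc_envelope u) \<le> Limsup (at_right 0) (\<lambda>\<delta>. wcap \<delta> (usc_envelope u) * ennreal (h \<delta>))"
    using sets_borel_restr closed_usc_envelope_ge
  proof (rule nn_integral_le_if_closed_levels, goal_cases)
    case V: (1 V D r)
    show ?case
    proof (cases rule: emeasure_borel_restr_cases[of "upper_box dist h :: 'a set \<Rightarrow> ennreal"])
      case 1
      then show ?thesis
        using V by (intro sum_upper_box_le_Limsup_wcap[OF sets_borel_restr, where r = r]) auto
    qed simp
  qed
  also have "\<dots> \<le> Limsup (at_right 0) (\<lambda>\<delta>. wcap \<delta> u * ennreal (h \<delta>))"
    by (intro Limsup_mono always_eventually allI mult_right_mono wcap_usc_envelope_le) auto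
  finally show ?thesis
    using upper_integral_le_usc_envelope[OF sets_borel_restr] order_trans by blast
qed

lemma upper_integral_le_Liminf_wcap:
  fixes u :: "'a::metric_space \<Rightarrow> ennreal"
  shows "upper_integral (borel_restr (lower_box dist h)) u \<le> Liminf (at_right 0) (\<lambda>\<delta>. wcap \<delta> u * ennreal (h \<delta>))"
proof -
  let ?M = "borel_restr (lower_box dist h) :: 'a measure"
  have "integral\<^sup>N ?M (usc_envelope u) \<le> Liminf (at_right 0) (\<lambda>\<delta>. wcap \<delta> (usc_envelope u) * ennreal (h \<delta>))"
    using sets_borel_restr closed_usc_envelope_ge
  proof (rule nn_integral_le_if_closed_levels, goal_cases)
    case V: (1 V D r)
    show ?case
    proof (cases rule: emeasure_borel_restr_cases[of "lower_box dist h :: 'a set \<Rightarrow> ennreal"])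
      case 1
      then have "(\<Sum>c\<in>V. c * emeasure ?M (D c)) = (\<Sum>c\<in>V. c * lower_box dist h (D c))"
        using V(4) by (intro sum.cong) auto
      also have "\<dots> \<le> Liminf (at_right 0) (\<lambda>\<delta>. wcap \<delta> (usc_envelope u) * ennreal (h \<delta>))"
        using V by (intro sum_lower_box_le_Liminf_wcap[of V r D]) auto
      finally show ?thesis .
    qed simp
  qed
  also have "\<dots> \<le> Liminf (at_right 0) (\<lambda>\<delta>. wcap \<delta> u * ennreal (h \<delta>))"
    by (intro Liminf_mono always_eventually allI mult_right_mono wcap_usc_envelope_le) auto
  finally show ?thesis
    using upper_integral_le_usc_envelope[OF sets_borel_restr] order_trans by blast
qed

text \<open>Countably many majorants realise the infimum of the integrals, and their pointwise
  infimum is again a Borel majorant.\<close>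

lemma upper_integral_attained:
  obtains \<phi> where "\<phi> \<in> borel_measurable M" "\<And>x. f x \<le> \<phi> x" "integral\<^sup>N M \<phi> = upper_integral M f"
proof -
  let ?A = "{\<phi>. \<phi> \<in> borel_measurable M \<and> (\<forall>x. f x \<le> \<phi> x)}"
  have "(\<lambda>_. top) \<in> ?A" by auto
  then have "integral\<^sup>N M ` ?A \<noteq> {}" by blast
  from ennreal_Inf_countable_INF[OF this] obtain a :: "nat \<Rightarrow> ennreal"
    where a: "range a \<subseteq> integral\<^sup>N M ` ?A" "Inf (integral\<^sup>N M ` ?A) = (INF i. a i)" by metis
  have UI: "upper_integral M f = (INF i. a i)" unfolding upper_integral_def by (rule a(2))
  have "\<exists>\<phi>. \<phi> \<in> ?A \<and> a i = integral\<^sup>N M \<phi>" for i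
    using subsetD[OF a(1) rangeI[of a i]] by blast
  then obtain \<phi> where \<phi>: "\<And>i. \<phi> i \<in> ?A" "\<And>i. a i = integral\<^sup>N M (\<phi> i)" by metis
  define \<psi> where "\<psi> x = (INF i. \<phi> i x)" for x
  have [measurable]: "\<phi> i \<in> borel_measurable M" for i using \<phi>(1) by auto
  have \<psi>: "\<psi> \<in> borel_measurable M" unfolding \<psi>_def by measurable
  have le: "f x \<le> \<psi> x" for x unfolding \<psi>_def using \<phi>(1) by (intro INF_greatest) auto
  have "integral\<^sup>N M \<psi> \<le> upper_integral M f"
    unfolding UI \<phi>(2) \<psi>_def by (intro INF_greatest nn_integral_mono INF_lower) auto
  moreover have "upper_integral M f \<le> integral\<^sup>N M \<psi>"
    unfolding upper_integral_def using \<psi> le by (intro INF_lower) auto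
  ultimately show ?thesis using that[OF \<psi> le] by simp
qed

text \<open>Optimal majorants of an increasing sequence need not increase; their lower limit still
  majorises the supremum, and Fatou's lemma replaces monotone convergence.\<close>

lemma upper_integral_le_if_le_SUP:
  assumes f: "\<And>x. f x \<le> (SUP n::nat. u n x)" and inc: "\<And>x. incseq (\<lambda>n. u n x)"
    and L: "\<And>n. upper_integral M (u n) \<le> L"
  shows "upper_integral M f \<le> L"
proof -
  have "\<exists>\<phi>. \<phi> \<in> borel_measurable M \<and> (\<forall>x. u n x \<le> \<phi> x) \<and> integral\<^sup>N M \<phi> = upper_integral M (u n)" for n
    by (metis upper_integral_attained)
  then obtain \<phi> where \<phi>[measurable]: "\<And>n. \<phi> n \<in> borel_measurable M"
    and ge: "\<And>n x. u n x \<le> \<phi> n x" and int: "\<And>n. integral\<^sup>N M (\<phi> n) = upper_integral M (u n)" by metis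
  have "f x \<le> liminf (\<lambda>n. \<phi> n x)" for x
  proof -
    have "u n x \<le> liminf (\<lambda>n. \<phi> n x)" for n
      using inc[of x] ge[of _ x]
      by (intro Liminf_bounded eventually_sequentiallyI[of n]) (auto simp: incseq_def intro: order_trans)
    then show ?thesis using f[of x] by (meson SUP_least order_trans)
  qed
  then have "upper_integral M f \<le> (\<integral>\<^sup>+x. liminf (\<lambda>n. \<phi> n x) \<partial>M)"
    unfolding upper_integral_def by (intro INF_lower) auto
  also have "\<dots> \<le> liminf (\<lambda>n. integral\<^sup>N M (\<phi> n))"
    by (rule nn_integral_liminf) auto
  also have "\<dots> \<le> L"
    unfolding int using L by (intro Liminf_le) auto
  finally show ?thesis .
qed

text \<open>The sum of optimal majorants is a majorant of the sum.\<close>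

lemma upper_integral_le_suminf:
  assumes f: "\<And>x. f x \<le> (\<Sum>n::nat. u n x)"
  shows "upper_integral M f \<le> (\<Sum>n. upper_integral M (u n))"
proof -
  have "\<exists>\<phi>. \<phi> \<in> borel_measurable M \<and> (\<forall>x. u n x \<le> \<phi> x) \<and> integral\<^sup>N M \<phi> = upper_integral M (u n)" for n
    by (metis upper_integral_attained)
  then obtain \<phi> where \<phi>[measurable]: "\<And>n. \<phi> n \<in> borel_measurable M"
    and ge: "\<And>n x. u n x \<le> \<phi> n x" and int: "\<And>n. integral\<^sup>N M (\<phi> n) = upper_integral M (u n)" by metis
  have "f x \<le> (\<Sum>n. \<phi> n x)" for x
    using f[of x] suminf_le[of "\<lambda>n. u n x" "\<lambda>n. \<phi> n x"] ge order_trans by blast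
  then have "upper_integral M f \<le> (\<integral>\<^sup>+x. (\<Sum>n. \<phi> n x) \<partial>M)"
    unfolding upper_integral_def by (intro INF_lower) auto
  also have "\<dots> = (\<Sum>n. upper_integral M (u n))"
    by (subst nn_integral_suminf) (auto simp: int)
  finally show ?thesis .
qed

section \<open>Separated sets in the product and their sections\<close>

text \<open>In the maximum metric two points of \<open>Sigma F G\<close> are separated by the first
  coordinate if they lie over different base points, and otherwise by the second.\<close>

lemma sum_capC_xsection_le:
  fixes E :: "('a::metric_space \<times> 'b::metric_space) set"
  assumes F: "F \<in> separated dist \<delta> UNIV"
  shows "(\<Sum>x\<in>F. capC dist \<delta> (xsection E x)) \<le> capC maxdist \<delta> E"
  unfolding capC_eq_SUP_separated[of dist]
proof (rule sum_SUP_le[OF separated_finite[OF F]])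
  fix x show "separated dist \<delta> (xsection E x) \<noteq> {}" using separated_empty by blast
next
  fix G assume G: "\<And>x. x \<in> F \<Longrightarrow> G x \<in> separated dist \<delta> (xsection E x)"
  have fin: "finite F" "\<And>x. x \<in> F \<Longrightarrow> finite (G x)"
    using F G separated_finite by blast+
  have "Sigma F G \<in> separated maxdist \<delta> E"
  proof (rule separatedI)
    show "Sigma F G \<subseteq> E" using separated_subset[OF G] by (auto simp: xsection_def)
    fix p q assume pq: "p \<in> Sigma F G" "q \<in> Sigma F G" "p \<noteq> q"
    then obtain x y x' y' where *: "p = (x, y)" "q = (x', y')" "x \<in> F" "x' \<in> F" "y \<in> G x" "y' \<in> G x'" by auto
    show "\<delta> < maxdist p q"
    proof (cases "x = x'")
      case True
      then have "\<delta> < dist y y'" using * pq(3) separatedD[OF G[of x], of y y'] by auto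
      then show ?thesis by (simp add: maxdist_def *)
    next
      case False
      then have "\<delta> < dist x x'" using * separatedD[OF F, of x x'] by auto
      then show ?thesis by (simp add: maxdist_def *)
    qed
  qed (use fin in auto)
  then have "of_nat (card (Sigma F G)) \<le> capC maxdist \<delta> E"
    unfolding capC_eq_SUP_separated by (intro SUP_upper)
  then show "(\<Sum>x\<in>F. of_nat (card (G x))) \<le> capC maxdist \<delta> E"
    using fin by (simp add: card_SigmaI)
qed

text \<open>The weight \<open>u\<close> of the introduction: an infimum over a whole range of
  scales, so that one function of the base point serves all small \<open>\<delta>\<close> at
  once.\<close>

definition low_cap :: "(real \<Rightarrow> real) \<Rightarrow> nat \<Rightarrow> 'b::metric_space set \<Rightarrow> ennreal" where
  "low_cap g n A = (INF \<delta>\<in>{0<..<1 / real (Suc n)}. capC dist \<delta> A * ennreal (g \<delta>))"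

lemma low_cap_mono: "A \<subseteq> B \<Longrightarrow> m \<le> n \<Longrightarrow> low_cap g m A \<le> low_cap g n B"
  unfolding low_cap_def
proof (rule INF_superset_mono)
  assume "m \<le> n"
  then have "1 / real (Suc n) \<le> 1 / real (Suc m)" by (simp add: field_simps)
  then show "{0<..<1 / real (Suc n)} \<subseteq> {0<..<1 / real (Suc m)}" by auto
qed (intro mult_right_mono capC_mono, auto)

lemma incseq_low_cap: "incseq (\<lambda>n. low_cap g n A)"
  by (simp add: incseq_def low_cap_mono)

lemma lower_box0_le_SUP_low_cap: "lower_box0 dist g A \<le> (SUP n. low_cap g n A)"
  unfolding lower_box0_def Liminf_def
proof (rule SUP_least, safe)
  fix P assume "eventually P (at_right (0::real))"
  then obtain b where b: "b > 0" "\<And>\<delta>. 0 < \<delta> \<Longrightarrow> \<delta> < b \<Longrightarrow> P \<delta>"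
    by (auto simp: eventually_at_right_field)
  obtain n where "1 / real (Suc n) < b" using nat_approx_posE[OF b(1)] by auto
  then have "(INF \<delta>\<in>Collect P. capC dist \<delta> A * ennreal (g \<delta>)) \<le> low_cap g n A"
    unfolding low_cap_def using b(2) by (intro INF_superset_mono) auto
  then show "(INF \<delta>\<in>Collect P. capC dist \<delta> A * ennreal (g \<delta>)) \<le> (SUP n. low_cap g n A)"
    by (meson SUP_upper2 UNIV_I)
qed

lemma eventually_wcap_low_cap_le:
  fixes E :: "('a::metric_space \<times> 'b::metric_space) set"
  assumes "hausdorff_fun g"
  shows "\<forall>\<^sub>F \<delta> in at_right 0. wcap \<delta> (\<lambda>x. low_cap g n (xsection E x)) * ennreal (h \<delta>)
    \<le> capC maxdist \<delta> E * ennreal (g \<delta> * h \<delta>)"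
proof -
  have "0 < 1 / real (Suc n)" by simp
  from eventually_at_right_real[OF this] show ?thesis
  proof eventually_elim
    case (elim \<delta>)
    have "wcap \<delta> (\<lambda>x. low_cap g n (xsection E x)) \<le> capC maxdist \<delta> E * ennreal (g \<delta>)"
      unfolding wcap_def
    proof (rule SUP_least)
      fix F :: "'a set" assume F: "F \<in> separated dist \<delta> UNIV"
      have "(\<Sum>x\<in>F. low_cap g n (xsection E x)) \<le> (\<Sum>x\<in>F. capC dist \<delta> (xsection E x) * ennreal (g \<delta>))"
        unfolding low_cap_def using elim by (intro sum_mono INF_lower) auto
      also have "\<dots> \<le> capC maxdist \<delta> E * ennreal (g \<delta>)"
        unfolding sum_distrib_right[symmetric] by (intro mult_right_mono sum_capC_xsection_le F) auto
      finally show "(\<Sum>x\<in>F. low_cap g n (xsection E x)) \<le> capC maxdist \<delta> E * ennreal (g \<delta>)" .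
    qed
    then have "wcap \<delta> (\<lambda>x. low_cap g n (xsection E x)) * ennreal (h \<delta>) \<le> capC maxdist \<delta> E * ennreal (g \<delta>) * ennreal (h \<delta>)"
      by (rule mult_right_mono) auto
    \<comment> \<open>Allows \<open>ennreal (g \<delta> * h \<delta>)\<close> to be split into two
      factors.\<close>
    moreover have "0 \<le> g \<delta>" using assms elim by (auto simp: hausdorff_fun_def intro: less_imp_le)
    ultimately show ?case by (simp add: ennreal_mult' mult.assoc)
  qed
qed

section \<open>Inequalities for the box contents\<close>

text \<open>Each \<open>low_cap\<close> weight is controlled through \<open>wcap\<close>; increasing
  \<open>n\<close> reaches \<open>lower_box0\<close> of the sections.\<close>

lemma upper_integral_section_le_upper_box0:
  fixes E :: "('a::metric_space \<times> 'b::metric_space) set"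
  assumes "hausdorff_fun g"
  shows "upper_integral (borel_restr (upper_box dist h)) (\<lambda>x. lower_box0 dist g (xsection E x))
    \<le> upper_box0 maxdist (\<lambda>t. g t * h t) E"
proof (rule upper_integral_le_if_le_SUP[OF lower_box0_le_SUP_low_cap incseq_low_cap])
  fix n
  show "upper_integral (borel_restr (upper_box dist h)) (\<lambda>x. low_cap g n (xsection E x))
    \<le> upper_box0 maxdist (\<lambda>t. g t * h t) E"
    unfolding upper_box0_def
    by (rule order_trans[OF upper_integral_le_Limsup_wcap Limsup_mono[OF eventually_wcap_low_cap_le[OF assms]]])
qed

lemma upper_integral_section_le_lower_box0:
  fixes E :: "('a::metric_space \<times> 'b::metric_space) set"
  assumes "hausdorff_fun g"
  shows "upper_integral (borel_restr (lower_box dist h)) (\<lambda>x. lower_box0 dist g (xsection E x))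
    \<le> lower_box0 maxdist (\<lambda>t. g t * h t) E"
proof (rule upper_integral_le_if_le_SUP[OF lower_box0_le_SUP_low_cap incseq_low_cap])
  fix n
  show "upper_integral (borel_restr (lower_box dist h)) (\<lambda>x. low_cap g n (xsection E x))
    \<le> lower_box0 maxdist (\<lambda>t. g t * h t) E"
    unfolding lower_box0_def
    by (rule order_trans[OF upper_integral_le_Liminf_wcap Liminf_mono[OF eventually_wcap_low_cap_le[OF assms]]])
qed

section \<open>From contents to the four product inequalities\<close>

lemma arrow_box_xsection_le_SUP:
  assumes "incseq A" and "(\<Union>n. A n) = E"
  shows "arrow_box dist g (xsection E x) \<le> (SUP n. lower_box0 dist g (xsection (A n) x))"
  unfolding arrow_box_def arrow_def
proof (rule INF_lower, safe)
  show "incseq (\<lambda>n. xsection (A n) x)"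
    using incseqD[OF assms(1)] by (auto simp: incseq_def xsection_def)
qed (use assms(2) in \<open>auto simp: xsection_def\<close>)

lemma incseq_lower_box0_xsection:
  "incseq A \<Longrightarrow> incseq (\<lambda>n. lower_box0 dist g (xsection (A n) x))"
  by (auto simp: incseq_def xsection_def intro!: lower_box0_mono)

text \<open>Partial unions of a cover exhaust \<open>E\<close>, hence their sections test
  \<open>arrow_box\<close> of the sections of \<open>E\<close>. Finite subadditivity of
  \<open>upper_box0\<close> bounds every partial union by the full sum.\<close>

lemma upper_integral_arrow_le_upper_box:
  fixes E :: "('a::metric_space \<times> 'b::metric_space) set"
  assumes "hausdorff_fun g"
  shows "upper_integral (borel_restr (upper_box dist h)) (\<lambda>x. arrow_box dist g (xsection E x))
    \<le> upper_box maxdist (\<lambda>t. g t * h t) E"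
  unfolding upper_box_def[of maxdist] hat_def
proof (rule INF_greatest, safe)
  fix A :: "nat \<Rightarrow> ('a \<times> 'b) set" assume A: "E \<subseteq> (\<Union>n. A n)"
  \<comment> \<open>Intersecting with \<open>E\<close> is essential: \<open>arrow\<close> wants the
    union to be exactly \<open>E\<close>.\<close>
  define B where "B n = E \<inter> (\<Union>j\<in>{..<n}. A j)" for n
  have inc: "incseq B" unfolding B_def by (force simp: incseq_def)
  have UN: "(\<Union>n. B n) = E"
  proof (intro equalityI subsetI)
    fix p assume p: "p \<in> E"
    then obtain n where "p \<in> A n" using A by blast
    then have "p \<in> B (Suc n)" using p by (auto simp: B_def)
    then show "p \<in> (\<Union>n. B n)" by blast
  qed (auto simp: B_def)
  show "upper_integral (borel_restr (upper_box dist h)) (\<lambda>x. arrow_box dist g (xsection E x))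
    \<le> (\<Sum>n. upper_box0 maxdist (\<lambda>t. g t * h t) (A n))"
  proof (rule upper_integral_le_if_le_SUP[OF arrow_box_xsection_le_SUP[OF inc UN] incseq_lower_box0_xsection[OF inc]])
    fix n
    have "upper_integral (borel_restr (upper_box dist h)) (\<lambda>x. lower_box0 dist g (xsection (B n) x))
      \<le> upper_box0 maxdist (\<lambda>t. g t * h t) (B n)"
      by (rule upper_integral_section_le_upper_box0[OF assms])
    also have "\<dots> \<le> upper_box0 maxdist (\<lambda>t. g t * h t) (\<Union>j\<in>{..<n}. A j)"
      by (rule upper_box0_mono) (auto simp: B_def)
    also have "\<dots> \<le> (\<Sum>j\<in>{..<n}. upper_box0 maxdist (\<lambda>t. g t * h t) (A j))"
      by (rule upper_box0_UN_le) auto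
    also have "\<dots> \<le> (\<Sum>n. upper_box0 maxdist (\<lambda>t. g t * h t) (A n))"
      by (rule sum_le_suminf) auto
    finally show "upper_integral (borel_restr (upper_box dist h)) (\<lambda>x. lower_box0 dist g (xsection (B n) x))
      \<le> (\<Sum>n. upper_box0 maxdist (\<lambda>t. g t * h t) (A n))" .
  qed
qed

text \<open>The sections of a cover are a cover of the section, and upper integrals are countably
  subadditive, so the content inequality is summed over the members.\<close>

lemma upper_integral_lower_le_lower_box:
  fixes E :: "('a::metric_space \<times> 'b::metric_space) set"
  assumes "hausdorff_fun g"
  shows "upper_integral (borel_restr (lower_box dist h)) (\<lambda>x. lower_box dist g (xsection E x))
    \<le> lower_box maxdist (\<lambda>t. g t * h t) E"
  unfolding lower_box_def[of maxdist] hat_def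
proof (rule INF_greatest, safe)
  fix A :: "nat \<Rightarrow> ('a \<times> 'b) set" assume A: "E \<subseteq> (\<Union>n. A n)"
  have "lower_box dist g (xsection E x) \<le> (\<Sum>n. lower_box0 dist g (xsection (A n) x))" for x
    unfolding lower_box_def hat_def using A by (intro INF_lower) (auto simp: xsection_def)
  then have "upper_integral (borel_restr (lower_box dist h)) (\<lambda>x. lower_box dist g (xsection E x))
    \<le> (\<Sum>n. upper_integral (borel_restr (lower_box dist h)) (\<lambda>x. lower_box0 dist g (xsection (A n) x)))"
    by (rule upper_integral_le_suminf)
  also have "\<dots> \<le> (\<Sum>n. lower_box0 maxdist (\<lambda>t. g t * h t) (A n))"
    by (intro suminf_le upper_integral_section_le_lower_box0 assms) auto
  finally show "upper_integral (borel_restr (lower_box dist h)) (\<lambda>x. lower_box dist g (xsection E x))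
    \<le> (\<Sum>n. lower_box0 maxdist (\<lambda>t. g t * h t) (A n))" .
qed

lemma upper_integral_arrow_le_arrow_box:
  fixes E :: "('a::metric_space \<times> 'b::metric_space) set"
  assumes "hausdorff_fun g"
  shows "upper_integral (borel_restr (lower_box dist h)) (\<lambda>x. arrow_box dist g (xsection E x))
    \<le> arrow_box maxdist (\<lambda>t. g t * h t) E"
  unfolding arrow_box_def[of maxdist] arrow_def
proof (rule INF_greatest)
  fix A :: "nat \<Rightarrow> ('a \<times> 'b) set" assume "A \<in> {A. incseq A \<and> (\<Union>n. A n) = E}"
  then have A: "incseq A" "(\<Union>n. A n) = E" by simp_all
  show "upper_integral (borel_restr (lower_box dist h)) (\<lambda>x. arrow_box dist g (xsection E x))
    \<le> (SUP n. lower_box0 maxdist (\<lambda>t. g t * h t) (A n))"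
  proof (rule upper_integral_le_if_le_SUP[OF arrow_box_xsection_le_SUP[OF A] incseq_lower_box0_xsection[OF A(1)]])
    fix n
    have "upper_integral (borel_restr (lower_box dist h)) (\<lambda>x. lower_box0 dist g (xsection (A n) x))
      \<le> lower_box0 maxdist (\<lambda>t. g t * h t) (A n)"
      by (rule upper_integral_section_le_lower_box0[OF assms])
    also have "\<dots> \<le> (SUP n. lower_box0 maxdist (\<lambda>t. g t * h t) (A n))"
      by (rule SUP_upper) simp
    finally show "upper_integral (borel_restr (lower_box dist h)) (\<lambda>x. lower_box0 dist g (xsection (A n) x))
      \<le> (SUP n. lower_box0 maxdist (\<lambda>t. g t * h t) (A n))" .
  qed
qed

text \<open>For \<open>s\<close> below the infimum, the base points whose sections already have
  \<open>low_cap\<close> at least \<open>s\<close> exhaust the first factor and thereby test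
  \<open>arrow_box\<close> there; over each such set the weight is at least
  \<open>s\<close>.\<close>

lemma INF_arrow_mult_le_arrow_box:
  fixes E :: "('a::metric_space \<times> 'b::metric_space) set"
  assumes "hausdorff_fun g"
  shows "(INF x. arrow_box dist g (xsection E x)) * arrow_box (dist :: 'a \<Rightarrow> 'a \<Rightarrow> real) h UNIV
    \<le> arrow_box maxdist (\<lambda>t. g t * h t) E"
  unfolding arrow_box_def[of maxdist] arrow_def[of _ E]
proof (rule INF_greatest)
  fix A :: "nat \<Rightarrow> ('a \<times> 'b) set" assume "A \<in> {A. incseq A \<and> (\<Union>n. A n) = E}"
  then have A: "incseq A" "(\<Union>n. A n) = E" by simp_all
  let ?I = "INF x. arrow_box dist g (xsection E x)"
  let ?R = "SUP n. lower_box0 maxdist (\<lambda>t. g t * h t) (A n)"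
  have *: "s * arrow_box (dist :: 'a \<Rightarrow> 'a \<Rightarrow> real) h UNIV \<le> ?R" if s: "s < ?I" for s
  proof -
    \<comment> \<open>The index \<open>n\<close> serves both the exhaustion and the range of scales;
      by monotonicity in both, \<open>max n m\<close> merges two separate choices.\<close>
    define B where "B n = {x. s \<le> low_cap g n (xsection (A n) x)}" for n
    have "incseq B"
    proof (rule incseq_SucI, unfold B_def, safe)
      fix n x assume "s \<le> low_cap g n (xsection (A n) x)"
      also have "\<dots> \<le> low_cap g (Suc n) (xsection (A (Suc n)) x)"
        using incseq_SucD[OF A(1), of n] by (intro low_cap_mono) (auto simp: xsection_def)
      finally show "s \<le> low_cap g (Suc n) (xsection (A (Suc n)) x)" .
    qed
    moreover have "(\<Union>n. B n) = UNIV"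
    proof (intro UNIV_eq_I[symmetric])
      fix x
      have "s < arrow_box dist g (xsection E x)"
        using s by (rule less_le_trans) (auto intro: INF_lower)
      also have "\<dots> \<le> (SUP n. lower_box0 dist g (xsection (A n) x))"
        by (rule arrow_box_xsection_le_SUP[OF A])
      finally obtain n where "s < lower_box0 dist g (xsection (A n) x)" by (auto simp: less_SUP_iff)
      then have "s < (SUP m. low_cap g m (xsection (A n) x))"
        using lower_box0_le_SUP_low_cap less_le_trans by blast
      then obtain m where m: "s < low_cap g m (xsection (A n) x)" by (auto simp: less_SUP_iff)
      also have "\<dots> \<le> low_cap g (max n m) (xsection (A (max n m)) x)"
        using incseqD[OF A(1), of n "max n m"] by (intro low_cap_mono) (auto simp: xsection_def)
      finally have "x \<in> B (max n m)" by (simp add: B_def)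
      then show "x \<in> (\<Union>n. B n)" by blast
    qed
    ultimately have "arrow_box dist h (UNIV :: 'a set) \<le> (SUP n. lower_box0 dist h (B n))"
      unfolding arrow_box_def arrow_def by (intro INF_lower) auto
    then have "s * arrow_box dist h (UNIV :: 'a set) \<le> (SUP n. s * lower_box0 dist h (B n))"
      unfolding SUP_mult_left_ennreal[symmetric] by (rule mult_left_mono) auto
    also have "\<dots> \<le> ?R"
    proof (rule SUP_mono, intro bexI)
      fix n
      have "s * lower_box0 dist h (B n) \<le> Liminf (at_right 0) (\<lambda>\<delta>. s * (capC dist \<delta> (B n) * ennreal (h \<delta>)))"
        unfolding lower_box0_def by (rule mult_Liminf_le)
      also have "\<dots> \<le> Liminf (at_right 0) (\<lambda>\<delta>. wcap \<delta> (\<lambda>x. low_cap g n (xsection (A n) x)) * ennreal (h \<delta>))"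
      proof (rule Liminf_mono)
        have "\<forall>\<^sub>F \<delta> in at_right 0. (\<Sum>i\<in>{n}. s * (capC dist \<delta> (B i) * ennreal (h \<delta>)))
            \<le> wcap \<delta> (\<lambda>x. low_cap g n (xsection (A n) x)) * ennreal (h \<delta>)"
          \<comment> \<open>With a single piece the distance condition is vacuous, so any positive
            \<open>r\<close> will do.\<close>
          by (rule eventually_sum_capC_le_wcap[where r = 1]) (simp_all add: B_def)
        then show "\<forall>\<^sub>F \<delta> in at_right 0. s * (capC dist \<delta> (B n) * ennreal (h \<delta>))
            \<le> wcap \<delta> (\<lambda>x. low_cap g n (xsection (A n) x)) * ennreal (h \<delta>)"
          by simp
      qed
      also have "\<dots> \<le> lower_box0 maxdist (\<lambda>t. g t * h t) (A n)"
        unfolding lower_box0_def by (rule Liminf_mono[OF eventually_wcap_low_cap_le[OF assms]])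
      finally show "s * lower_box0 dist h (B n) \<le> lower_box0 maxdist (\<lambda>t. g t * h t) (A n)" .
    qed simp
    finally show ?thesis .
  qed
  \<comment> \<open>Strictness of \<open>s < ?I\<close> was needed to pick indices from suprema;
    density of the order recovers \<open>?I\<close>, also when it is 0 or
    \<open>top\<close>.\<close>
  have "?I \<le> Sup {..<?I}"
    by (rule dense_le) (auto intro: Sup_upper)
  then have "?I * arrow_box (dist :: 'a \<Rightarrow> 'a \<Rightarrow> real) h UNIV \<le> (SUP s\<in>{..<?I}. s) * arrow_box dist h (UNIV :: 'a set)"
    by (intro mult_right_mono) auto
  also have "\<dots> = (SUP s\<in>{..<?I}. s * arrow_box dist h (UNIV :: 'a set))"
    by (rule SUP_mult_right_ennreal)
  also have "\<dots> \<le> ?R" using * by (intro SUP_least) auto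
  finally show "?I * arrow_box (dist :: 'a \<Rightarrow> 'a \<Rightarrow> real) h UNIV \<le> ?R" .
qed

theorem theorem3p9:
  fixes g h :: "real \<Rightarrow> real" and E :: "('a::metric_space \<times> 'b::metric_space) set"
  assumes "hausdorff_fun g" and "hausdorff_fun h"
  shows "(upper_box maxdist (\<lambda>t. g t * h t) E
           \<ge> upper_integral (borel_restr (upper_box dist h)) (\<lambda>x. arrow_box dist g (xsection E x)))
       \<and> (lower_box maxdist (\<lambda>t. g t * h t) E
           \<ge> upper_integral (borel_restr (lower_box dist h)) (\<lambda>x. lower_box dist g (xsection E x)))
       \<and> (arrow_box maxdist (\<lambda>t. g t * h t) E
           \<ge> upper_integral (borel_restr (lower_box dist h)) (\<lambda>x. arrow_box dist g (xsection E x)))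
       \<and> (arrow_box maxdist (\<lambda>t. g t * h t) E
           \<ge> (INF x. arrow_box dist g (xsection E x)) * arrow_box (dist :: 'a \<Rightarrow> 'a \<Rightarrow> real) h UNIV)"
  using upper_integral_arrow_le_upper_box[OF assms(1)] upper_integral_lower_le_lower_box[OF assms(1)]
    upper_integral_arrow_le_arrow_box[OF assms(1)] INF_arrow_mult_le_arrow_box[OF assms(1)]
  by (intro conjI)

end
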